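(* Let $A$ be a complex Banach algebra with a right identity $u$ (that is, $au=a$ for all $a\in A$) such that $uA=\{ua : a\in A\}$ is commutative and semisimple. Let $D: A\times A\to A$ be a symmetric bi-derivation. Then the range of $D$ is contained in $\mathrm{ran}(A)$; that is, $D(a,b)\in \mathrm{ran}(A)$ for all $a,b\in A$.
   Context: A mapping $D:A\times A\to A$ is called symmetric bi-linear if $D(a,b)=D(b,a)$, $D(\alpha a,b)=\alpha D(a,b)$ and $D(a+b,c)=D(a,c)+D(b,c)$ for all $a,b,c\in A$ and $\alpha\in\mathbb{C}$ (no continuity is assumed). A symmetric bi-derivation of $A$ is a symmetric bi-linear mapping $D:A\times A\to A$ such that $D(ab,c)=D(a,c)b+aD(b,c)$ for all $a,b,c\in A$. The right annihilator of $A$ is $\mathrm{ran}(A)=\{r\in A : ar=0 \text{ for all } a\in A\}$. *)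

theory Defs
  imports "HOL-Analysis.Analysis"
begin

text \<open>
  Complex Banach algebras, not assumed to be unital. The class \<^class>\<open>real_normed_algebra\<close>
  supplies the algebra structure and the submultiplicative norm, \<^class>\<open>banach\<close> supplies
  completeness; the complex scalar multiplication extends the real one.
\<close>

class complex_banach_algebra = real_normed_algebra + banach +
  fixes scaleC :: "complex \<Rightarrow> 'a \<Rightarrow> 'a"  (infixr \<open>*\<^sub>C\<close> 75)
  assumes scaleC_add_right: "\<alpha> *\<^sub>C (x + y) = \<alpha> *\<^sub>C x + \<alpha> *\<^sub>C y"
    and scaleC_add_left: "(\<alpha> + \<beta>) *\<^sub>C x = \<alpha> *\<^sub>C x + \<beta> *\<^sub>C x"
    and scaleC_scaleC: "\<alpha> *\<^sub>C (\<beta> *\<^sub>C x) = (\<alpha> * \<beta>) *\<^sub>C x"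
    and scaleC_of_real: "complex_of_real r *\<^sub>C x = r *\<^sub>R x"
    and mult_scaleC_left: "(\<alpha> *\<^sub>C x) * y = \<alpha> *\<^sub>C (x * y)"
    and mult_scaleC_right: "x * (\<alpha> *\<^sub>C y) = \<alpha> *\<^sub>C (x * y)"
    and norm_scaleC: "norm (\<alpha> *\<^sub>C x) = cmod \<alpha> * norm x"

global_interpretation complex_vector:
  vector_space "scaleC :: complex \<Rightarrow> 'a \<Rightarrow> 'a::complex_banach_algebra"
proof
  show "1 *\<^sub>C x = x" for x :: 'a
    using scaleC_of_real[of 1 x] by simp
qed (simp_all add: scaleC_add_right scaleC_add_left scaleC_scaleC)

text \<open>
  In the following, \<open>B\<close> is meant to be a complex subalgebra of the ambient algebra, and
  all notions are relative to \<open>B\<close> regarded as an algebra in its own right.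
\<close>

definition left_ideal_of :: "'a::complex_banach_algebra set \<Rightarrow> 'a set \<Rightarrow> bool" where
  "left_ideal_of B M \<longleftrightarrow>
     M \<subseteq> B \<and> complex_vector.subspace M \<and> (\<forall>b\<in>B. \<forall>m\<in>M. b * m \<in> M)"

definition modular_left_ideal_of :: "'a::complex_banach_algebra set \<Rightarrow> 'a set \<Rightarrow> bool" where
  "modular_left_ideal_of B M \<longleftrightarrow>
     left_ideal_of B M \<and> (\<exists>e\<in>B. \<forall>b\<in>B. b - b * e \<in> M)"

definition maximal_modular_left_ideal_of ::
    "'a::complex_banach_algebra set \<Rightarrow> 'a set \<Rightarrow> bool" where
  "maximal_modular_left_ideal_of B M \<longleftrightarrow>
     modular_left_ideal_of B M \<and> M \<noteq> B \<and>
     (\<forall>J. left_ideal_of B J \<and> M \<subseteq> J \<longrightarrow> J = M \<or> J = B)"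

text \<open>
  The Jacobson radical; it is all of \<open>B\<close> if there are no maximal modular left ideals.
\<close>

definition jacobson_radical_of :: "'a::complex_banach_algebra set \<Rightarrow> 'a set" where
  "jacobson_radical_of B = B \<inter> \<Inter> {M. maximal_modular_left_ideal_of B M}"

definition semisimple :: "'a::complex_banach_algebra set \<Rightarrow> bool" where
  "semisimple B \<longleftrightarrow> jacobson_radical_of B = {0}"

definition commutative :: "'a::complex_banach_algebra set \<Rightarrow> bool" where
  "commutative B \<longleftrightarrow> (\<forall>x\<in>B. \<forall>y\<in>B. x * y = y * x)"

definition right_annihilator :: "'a::complex_banach_algebra set" where
  "right_annihilator = {r. \<forall>a. a * r = 0}"

definition symmetric_bilinear ::
    "('a::complex_banach_algebra \<Rightarrow> 'a \<Rightarrow> 'a) \<Rightarrow> bool" where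
  "symmetric_bilinear D \<longleftrightarrow>
     (\<forall>a b. D a b = D b a) \<and>
     (\<forall>\<alpha> a b. D (\<alpha> *\<^sub>C a) b = \<alpha> *\<^sub>C D a b) \<and>
     (\<forall>a b c. D (a + b) c = D a c + D b c)"

definition symmetric_biderivation ::
    "('a::complex_banach_algebra \<Rightarrow> 'a \<Rightarrow> 'a) \<Rightarrow> bool" where
  "symmetric_biderivation D \<longleftrightarrow>
     symmetric_bilinear D \<and>
     (\<forall>a b c. D (a * b) c = D a c * b + a * D b c)"

end

theory Submission
  imports Defs
begin

text \<open>
  For a fixed second argument a symmetric bi-derivation is a derivation \<open>d\<close>, and the claim is that
  every derivation of \<open>A\<close> maps into \<open>ran(A)\<close>. Because \<open>a * u = a\<close>, an element \<open>r\<close> is in \<open>ran(A)\<close>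
  iff \<open>u * r = 0\<close>, the quotient \<open>A / ran(A)\<close> is isomorphic to \<open>uA\<close>, and \<open>d\<close> preserves
  \<open>ran(A)\<close>. So \<open>d\<close> induces a derivation on a commutative semisimple Banach algebra with unit,
  and the statement amounts to Johnson's theorem that such a derivation vanishes even if it is not
  assumed to be continuous.

  The link to analysis are the characters, i.e. the nonzero multiplicative functionals. Each maximal
  ideal of \<open>uA\<close> is the kernel of one by the Gelfand-Mazur theorem (\<open>spectrum_nonempty\<close>),
  so an element killed by all characters lies in \<open>ran(A)\<close> (\<open>characters_separate\<close>) and it has to
  be shown that \<open>\<phi> (d a) = 0\<close> for every character \<open>\<phi>\<close>.

  Continuity comes first. A gliding hump argument shows that \<open>\<phi> \<circ> d\<close> is discontinuous for at most
  finitely many characters (\<open>finite_discontinuous\<close>). An element that vanishes at all the others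
  vanishes at these as well, for otherwise there would be an idempotent concentrated at one of the
  exceptional characters, and derivations kill idempotents (\<open>vanishes_off_discontinuous\<close>). Thus
  the characters \<open>\<phi>\<close> with \<open>\<phi> \<circ> d\<close> continuous still separate points modulo \<open>ran(A)\<close>, and the closed
  graph theorem makes \<open>u * d\<close> bounded (\<open>bounded_linear_u_d\<close>).

  Boundedness then yields the vanishing as in the Singer-Wermer theorem: if \<open>\<phi> a = 0\<close>, then
  \<open>\<phi> (d\<^sup>n (a\<^sup>n)) = n! \<phi> (d a)\<^sup>n\<close>, while the left-hand side grows only geometrically
  (\<open>character_d_eq_0_on_kernel\<close>). The general case follows by subtracting \<open>\<phi> a\<close> times \<open>u\<close>.
\<close>

section \<open>Baire category, closed graphs and gliding humps\<close>

text \<open>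
  The Baire category theorem in the form in which both the closed graph theorem and the choice
  of an element with distinct character values consume it.
\<close>

lemma countable_closed_cover_has_interior:
  fixes C :: "'i \<Rightarrow> 'a::complete_space set"
  assumes "countable I" and "\<And>i. i \<in> I \<Longrightarrow> closed (C i)" and "(\<Union>i\<in>I. C i) = UNIV"
  obtains i where "i \<in> I" "interior (C i) \<noteq> {}"
proof -
  have "\<exists>i\<in>I. interior (C i) \<noteq> {}"
  proof (rule ccontr)
    assume "\<not> (\<exists>i\<in>I. interior (C i) \<noteq> {})"
    then have *: "\<And>T. T \<in> C ` I \<Longrightarrow> closedin euclidean T \<and> euclidean interior_of T = {}"
      using assms(2) by auto
    have "completely_metrizable_space (euclidean :: 'a topology)"
      by (rule completely_metrizable_space_euclidean)
    then have "euclidean interior_of (\<Union>(C ` I)) = {}"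
      using assms(1) by (intro Baire_category_alt *) auto
    then show False
      using assms(3) by simp
  qed
  then show ?thesis
    using that by blast
qed

lemma subspace_with_interior:
  fixes S :: "'a::real_normed_vector set"
  assumes "subspace S" and "interior S \<noteq> {}"
  shows "S = UNIV"
proof -
  obtain x e where "e > 0" and ball: "ball x e \<subseteq> S"
    using assms(2) by (metis all_not_in_conv mem_interior)
  have "y \<in> S" for y
  proof -
    define t where "t = e / (2 * (norm y + 1))"
    have "norm y + 1 > 0"
      by (simp add: add_nonneg_pos)
    then have "t > 0" and "t * norm y < e"
      using \<open>e > 0\<close> by (auto simp: t_def field_simps intro: add_nonneg_pos)
    then have "x + t *\<^sub>R y \<in> S" "x \<in> S"
      using ball \<open>e > 0\<close> by (auto simp: dist_norm subset_iff)
    then have "t *\<^sub>R y \<in> S"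
      using assms(1) by (metis add_diff_cancel_left' subspace_diff)
    then have "inverse t *\<^sub>R (t *\<^sub>R y) \<in> S"
      using assms(1) by (simp add: subspace_scale del: scaleR_scaleR)
    then show ?thesis
      using \<open>t > 0\<close> by simp
  qed
  then show ?thesis by auto
qed

text \<open>
  The Baire half of the closed graph theorem. Some closure of \<open>{x. norm (T x) \<le> m}\<close> contains a
  ball; subtracting its centre shows that every \<open>x\<close> is approximated, with error half its norm, by
  vectors on which \<open>T\<close> is controlled by \<open>norm x\<close>.
\<close>

lemma linear_dense_sublevel:
  fixes T :: "'a::banach \<Rightarrow> 'b::real_normed_vector"
  assumes "linear T"
  obtains K where "K \<ge> 0" and
    "\<And>x. \<exists>y. norm (T y) \<le> K * norm x \<and> norm (x - y) \<le> norm x / 2"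
proof -
  interpret T: linear T by fact
  define C where "C m = closure {x. norm (T x) \<le> real m}" for m
  have "(\<Union>m\<in>UNIV. C m) = UNIV"
  proof -
    have "x \<in> C (nat \<lceil>norm (T x)\<rceil>)" for x
      unfolding C_def by (rule closure_subset[THEN subsetD]) (simp add: real_nat_ceiling_ge)
    then show ?thesis by blast
  qed
  then obtain m where "interior (C m) \<noteq> {}"
    by (rule countable_closed_cover_has_interior[of UNIV C, rotated 2]) (auto simp: C_def)
  then obtain x0 r where "r > 0" and ball: "ball x0 r \<subseteq> C m"
    by (metis all_not_in_conv mem_interior)
  have near: "\<exists>y. norm (T y) \<le> 2 * real m \<and> norm (x - y) < \<epsilon>" if "norm x < r" "\<epsilon> > 0" for x \<epsilon>
  proof -
    have "x0 \<in> C m" "x0 + x \<in> C m"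
      using ball that \<open>r > 0\<close> by (auto simp: dist_norm subset_iff)
    then obtain y z where y: "norm (T y) \<le> real m" "dist y x0 < \<epsilon>/2"
      and z: "norm (T z) \<le> real m" "dist z (x0 + x) < \<epsilon>/2"
      unfolding C_def closure_approachable using \<open>\<epsilon> > 0\<close> half_gt_zero by blast
    have "norm (T (z - y)) \<le> 2 * real m"
      using y z norm_triangle_ineq4[of "T z" "T y"] by (simp add: T.diff)
    moreover have "x - (z - y) = (x0 + x - z) + (y - x0)"
      by simp
    then have "norm (x - (z - y)) = norm ((x0 + x - z) + (y - x0))"
      by (rule arg_cong)
    then have "norm (x - (z - y)) < \<epsilon>"
      using y z norm_triangle_ineq[of "x0 + x - z" "y - x0"]
      unfolding dist_norm norm_minus_commute[of z] by linarith
    ultimately show ?thesis by blast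
  qed
  show ?thesis
  proof (rule that[of "4 * real m / r"])
    show "0 \<le> 4 * real m / r"
      using \<open>r > 0\<close> by simp
    fix x
    show "\<exists>y. norm (T y) \<le> 4 * real m / r * norm x \<and> norm (x - y) \<le> norm x / 2"
    proof (cases "x = 0")
      case True
      then show ?thesis
        by (intro exI[of _ 0]) (simp add: T.zero)
    next
      case False
      define s where "s = r / (2 * norm x)"
      have "s > 0" and "norm (s *\<^sub>R x) < r"
        using False \<open>r > 0\<close> by (auto simp: s_def)
      then obtain y where y: "norm (T y) \<le> 2 * real m" "norm (s *\<^sub>R x - y) < s * (norm x / 2)"
        using near[of "s *\<^sub>R x" "s * (norm x / 2)"] False by auto
      have "norm (T (inverse s *\<^sub>R y)) = norm (T y) / s"
        using \<open>s > 0\<close> by (simp add: T.scale divide_inverse)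
      also have "\<dots> \<le> 2 * real m / s"
        using y \<open>s > 0\<close> by (simp add: divide_right_mono)
      also have "\<dots> = 4 * real m / r * norm x"
        using False \<open>r > 0\<close> by (simp add: s_def field_simps)
      finally have 1: "norm (T (inverse s *\<^sub>R y)) \<le> 4 * real m / r * norm x" .
      have "x - inverse s *\<^sub>R y = inverse s *\<^sub>R (s *\<^sub>R x - y)"
        using \<open>s > 0\<close> by (simp add: scaleR_diff_right)
      then have "norm (x - inverse s *\<^sub>R y) = norm (s *\<^sub>R x - y) / s"
        using \<open>s > 0\<close> by (simp add: divide_inverse)
      also have "\<dots> \<le> norm x / 2"
        using y \<open>s > 0\<close> by (simp add: field_simps)
      finally show ?thesis using 1 by blast
    qed
  qed
qed

text \<open>
  Iterating the approximation on the remainder writes \<open>x\<close> as a series along which \<open>T\<close> decays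
  geometrically; the closed graph is what allows \<open>T\<close> to be applied to the series termwise.
\<close>

theorem closed_graph_theorem:
  fixes T :: "'a::banach \<Rightarrow> 'b::banach"
  assumes "linear T"
    and graph: "\<And>X x y. X \<longlonglongrightarrow> x \<Longrightarrow> (\<lambda>n. T (X n)) \<longlonglongrightarrow> y \<Longrightarrow> T x = y"
  shows "bounded_linear T"
proof -
  interpret T: linear T by fact
  obtain K where "K \<ge> 0" and
    "\<And>x. \<exists>y. norm (T y) \<le> K * norm x \<and> norm (x - y) \<le> norm x / 2"
    using linear_dense_sublevel[OF assms(1)] by blast
  then obtain g where g: "\<And>x. norm (T (g x)) \<le> K * norm x" "\<And>x. norm (x - g x) \<le> norm x / 2"
    by metis
  have "norm (T x) \<le> norm x * (2 * K)" for x
  proof -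
    \<comment> \<open>\<open>r n\<close> is what remains of \<open>x\<close> after \<open>n\<close> approximations.\<close>
    define r where "r n = ((\<lambda>z. z - g z) ^^ n) x" for n
    have r0: "r 0 = x" and rSuc: "r (Suc n) = r n - g (r n)" for n
      by (simp_all add: r_def)
    have rbound: "norm (r n) \<le> norm x * (1/2) ^ n" for n
    proof (induction n)
      case (Suc n)
      then show ?case
        using g(2)[of "r n"] by (simp add: rSuc)
    qed (simp add: r0)
    have "(\<lambda>n. norm x * (1/2) ^ n) \<longlonglongrightarrow> norm x * 0"
      by (intro tendsto_mult_left LIMSEQ_power_zero) simp
    then have "(\<lambda>n. norm x * (1/2) ^ n) \<longlonglongrightarrow> 0"
      by simp
    then have "r \<longlonglongrightarrow> 0"
      by (rule Lim_null_comparison[rotated]) (simp add: rbound)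
    then have "(\<lambda>n. x - r n) \<longlonglongrightarrow> x - 0"
      by (intro tendsto_diff) auto
    then have X: "(\<lambda>n. x - r n) \<longlonglongrightarrow> x"
      by simp
    have partial: "T (x - r n) = (\<Sum>k<n. T (g (r k)))" for n
    proof (induction n)
      case (Suc n)
      have "x - r (Suc n) = (x - r n) + g (r n)"
        by (simp add: rSuc)
      then have "T (x - r (Suc n)) = T (x - r n) + T (g (r n))"
        by (simp only: T.add)
      then show ?case using Suc by simp
    qed (simp add: r0 T.zero)
    have terms: "norm (T (g (r k))) \<le> K * norm x * (1/2) ^ k" for k
      using g(1)[of "r k"] mult_left_mono[OF rbound[of k] \<open>K \<ge> 0\<close>] by (simp add: mult.assoc)
    have geo: "(\<lambda>k. K * norm x * (1/2) ^ k) sums (K * norm x * (1 / (1 - 1/2)))"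
      by (intro sums_mult geometric_sums) simp
    have summ: "summable (\<lambda>k. norm (T (g (r k))))"
      by (rule summable_comparison_test'[OF sums_summable[OF geo], of 0]) (use terms in simp)
    have "(\<lambda>n. T (x - r n)) \<longlonglongrightarrow> (\<Sum>k. T (g (r k)))"
      unfolding partial using summable_norm_cancel[OF summ] by (rule summable_LIMSEQ)
    then have "T x = (\<Sum>k. T (g (r k)))"
      using graph[OF X] by blast
    also have "norm \<dots> \<le> (\<Sum>k. norm (T (g (r k))))"
      by (rule summable_norm[OF summ])
    also have "\<dots> \<le> K * norm x * (1 / (1 - 1/2))"
      using suminf_le[OF terms summ sums_summable[OF geo]] sums_unique[OF geo] by simp
    finally show ?thesis by (simp add: mult_ac)
  qed
  then show ?thesis
    using assms(1) by (intro bounded_linear_intro[of T "2 * K"]) (simp_all add: T.add T.scale)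
qed

text \<open>
  Think of \<open>P n\<close> as \<open>P 0 \<circ> T 0 \<circ> \<dots> \<circ> T (n - 1)\<close>. If every \<open>\<psi> n \<circ> P n\<close> were unbounded, one
  could choose tiny vectors \<open>x n\<close> such that \<open>\<psi> n (P n (x n))\<close> exceeds by \<open>n\<close> everything which the
  earlier terms of \<open>\<Sum>k. P k (x k)\<close> contribute to \<open>\<psi> n\<close>. The later terms contribute nothing: their
  sum lies in the range of \<open>P (Suc n)\<close>, which \<open>\<psi> n\<close> annihilates. So \<open>\<psi>\<close> would be unbounded at the
  sum of the series. Since the \<open>\<psi> n\<close> need not be continuous, it is essential that they kill the
  tails exactly.
\<close>

lemma gliding_hump:
  fixes T :: "nat \<Rightarrow> 'a::banach \<Rightarrow> 'a" and \<psi> :: "nat \<Rightarrow> 'a \<Rightarrow> complex"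
    and P :: "nat \<Rightarrow> 'a \<Rightarrow> 'a"
  assumes T: "\<And>n. bounded_linear (T n)"
    and P_0: "bounded_linear (P 0)" and P_Suc: "\<And>n x. P (Suc n) x = P n (T n x)"
    and \<psi>_add: "\<And>n x y. \<psi> n (x + y) = \<psi> n x + \<psi> n y"
    and pointwise: "\<And>x. \<exists>K. \<forall>n. cmod (\<psi> n x) \<le> K"
    and kills: "\<And>n x. \<psi> n (P (Suc n) x) = 0"
  obtains n \<epsilon> K where "\<epsilon> > 0" "\<And>x. norm x \<le> \<epsilon> \<Longrightarrow> cmod (\<psi> n (P n x)) < K"
proof (rule ccontr)
  assume "\<not> thesis"
  with that have unbounded: "\<exists>x. norm x \<le> \<epsilon> \<and> cmod (\<psi> n (P n x)) \<ge> K" if "\<epsilon> > 0" for n \<epsilon> K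
    using \<open>\<epsilon> > 0\<close> by (meson not_less)
  have "\<exists>K\<ge>1. \<forall>x. norm (T n x) \<le> K * norm x" for n
  proof -
    obtain K where "\<forall>x. norm (T n x) \<le> norm x * K"
      using bounded_linear.bounded[OF T] by blast
    then have "norm (T n x) \<le> max 1 K * norm x" for x
      by (metis max.cobounded2 mult.commute mult_right_mono norm_ge_zero order_trans)
    then show ?thesis
      by (intro exI[of _ "max 1 K"]) auto
  qed
  then obtain k where k1: "\<And>n. k n \<ge> 1" and k: "\<And>n x. norm (T n x) \<le> k n * norm x"
    by metis
  define N where "N n = (\<Prod>i<n. k i)" for n
  have N1: "N n \<ge> 1" for n
    unfolding N_def by (rule prod_ge_1) (use k1 in auto)
  \<comment> \<open>\<open>N n\<close> bounds every composite of consecutive operators among \<open>T 0, \<dots>, T (n - 1)\<close>.\<close>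
  define \<epsilon> where "\<epsilon> n = (1/2) ^ n / N n" for n
  have \<epsilon>: "\<epsilon> n > 0" for n
    using N1[of n] by (simp add: \<epsilon>_def)
  define pick where
    "pick n s = (SOME x. norm x \<le> \<epsilon> n \<and> cmod (\<psi> n (P n x)) \<ge> real n + cmod (\<psi> n s))" for n s
  have pick: "norm (pick n s) \<le> \<epsilon> n"
    "cmod (\<psi> n (P n (pick n s))) \<ge> real n + cmod (\<psi> n s)" for n s
    using someI_ex[OF unbounded[OF \<epsilon>, where n = n and K = "real n + cmod (\<psi> n s)"]] by (auto simp: pick_def)
  define \<sigma> where "\<sigma> = rec_nat 0 (\<lambda>n s. s + P n (pick n s))"
  define x where "x n = pick n (\<sigma> n)" for n
  have \<sigma>_0: "\<sigma> 0 = 0" and \<sigma>_Suc: "\<sigma> (Suc n) = \<sigma> n + P n (x n)" for n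
    by (simp_all add: \<sigma>_def x_def)
  have P_lin: "bounded_linear (P n)" for n
  proof (induction n)
    case 0
    show ?case by (rule P_0)
  next
    case (Suc n)
    then show ?case
      using bounded_linear_compose[OF Suc T[of n]] by (simp add: P_Suc[abs_def])
  qed
  \<comment> \<open>\<open>W n j = T n \<circ> \<dots> \<circ> T (n + j - 1)\<close>, so that \<open>P n\<close> can be factored out of the tail of the series.\<close>
  define W where "W n j y = rec_nat (\<lambda>y. y) (\<lambda>j w y. w (T (n + j) y)) j y" for n j y
  have W_0: "W n 0 y = y" and W_Suc: "W n (Suc j) y = W n j (T (n + j) y)" for n j y
    by (simp_all add: W_def)
  have PW: "P n (W n j y) = P (n + j) y" for n j y
    by (induction j arbitrary: y) (simp_all add: W_0 W_Suc P_Suc)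
  have W_bound: "norm (W n j y) \<le> N (n + j) * norm y" for n j y
  proof (induction j arbitrary: y)
    case 0
    then show ?case
      using mult_right_mono[OF N1[of n], of "norm y"] by (simp add: W_0)
  next
    case (Suc j)
    have "norm (W n (Suc j) y) \<le> N (n + j) * norm (T (n + j) y)"
      using Suc by (simp add: W_Suc)
    also have "\<dots> \<le> N (n + j) * (k (n + j) * norm y)"
      using k N1[of "n + j"] by (intro mult_left_mono) auto
    finally show ?case by (simp add: N_def mult_ac)
  qed
  have x_bound: "norm (W n j (x (n + j))) \<le> (1/2) ^ j" for n j
  proof -
    have "norm (W n j (x (n + j))) \<le> N (n + j) * norm (x (n + j))"
      by (rule W_bound)
    also have "\<dots> \<le> N (n + j) * \<epsilon> (n + j)"
      using pick(1)[of "n + j" "\<sigma> (n + j)"] N1[of "n + j"]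
      by (intro mult_left_mono) (auto simp: x_def)
    also have "\<dots> = (1/2) ^ (n + j)"
      using N1[of "n + j"] by (simp add: \<epsilon>_def)
    also have "\<dots> \<le> (1/2) ^ j"
      by (rule power_decreasing) auto
    finally show ?thesis .
  qed
  have summ: "summable (\<lambda>j. W n j (x (n + j)))" for n
    by (rule summable_comparison_test'[of "\<lambda>j. (1/2::real) ^ j" 0])
      (use x_bound in \<open>auto intro: summable_geometric\<close>)
  define tail where "tail n = (\<Sum>j. W n j (x (n + j)))" for n
  have P_tail: "(\<lambda>j. P (n + j) (x (n + j))) sums P n (tail n)" for n
    using bounded_linear.sums[OF P_lin[of n] summable_sums[OF summ[of n]]]
    by (simp add: PW tail_def)
  have split: "P 0 (tail 0) = \<sigma> n + P n (tail n)" for n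
  proof -
    have "\<sigma> n = (\<Sum>j<n. P j (x j))"
      by (induction n) (simp_all add: \<sigma>_0 \<sigma>_Suc)
    moreover have "(\<lambda>j. P j (x j)) sums P 0 (tail 0)"
      using P_tail[of 0] by simp
    then have "(\<lambda>j. P (j + n) (x (j + n))) sums (P 0 (tail 0) - (\<Sum>j<n. P j (x j)))"
      by (subst sums_iff_shift) simp
    ultimately show ?thesis
      using sums_unique2[OF P_tail[of n]] by (simp add: add.commute)
  qed
  have "cmod (\<psi> n (P 0 (tail 0))) \<ge> real n" for n
  proof -
    have "\<psi> n (P 0 (tail 0)) = \<psi> n (\<sigma> n) + \<psi> n (P n (x n))"
      using split[of "Suc n"] kills[of n "tail (Suc n)"] by (simp add: \<psi>_add \<sigma>_Suc)
    moreover have "cmod (\<psi> n (P n (x n))) \<ge> real n + cmod (\<psi> n (\<sigma> n))"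
      using pick(2)[of n "\<sigma> n"] by (simp add: x_def)
    ultimately show ?thesis
      using norm_diff_ineq[of "\<psi> n (P n (x n))" "\<psi> n (\<sigma> n)"] by (simp add: add.commute)
  qed
  moreover obtain K where "\<And>n. cmod (\<psi> n (P 0 (tail 0))) \<le> K"
    using pointwise by blast
  ultimately have "\<And>n. real n \<le> K"
    using order_trans by blast
  then show False
    using reals_Archimedean2[of K] by (meson not_less)
qed

section \<open>The Gelfand-Mazur theorem for a quotient\<close>

text \<open>
  The quotient \<open>A / M\<close> is a commutative field with unit \<open>u + M\<close>, complete in the quotient norm. It
  depends on parameters of the context and so cannot become a type; it is handled through
  congruence modulo \<open>M\<close>.
\<close>

locale banach_field_quotient =
  fixes u :: "'a::complex_banach_algebra" and M :: "'a set"
  assumes right_unit [simp]: "a * u = a"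
    and subspace: "complex_vector.subspace M"
    and closed: "closed M"
    and absorb_left: "m \<in> M \<Longrightarrow> a * m \<in> M"
    and absorb_right: "m \<in> M \<Longrightarrow> m * a \<in> M"
    and commutator: "a * b - b * a \<in> M"
    and proper: "u \<notin> M"
    and invertible: "a \<notin> M \<Longrightarrow> \<exists>b. b * a - u \<in> M"
begin

definition cong :: "'a \<Rightarrow> 'a \<Rightarrow> bool"  (infix \<open>\<simeq>\<close> 50) where
  "a \<simeq> b \<longleftrightarrow> a - b \<in> M"

lemma cong_refl [simp]: "a \<simeq> a"
  by (simp add: cong_def complex_vector.subspace_0[OF subspace])

lemma cong_sym: "a \<simeq> b \<Longrightarrow> b \<simeq> a"
  using complex_vector.subspace_neg[OF subspace] by (force simp: cong_def)

lemma cong_trans [trans]: "a \<simeq> b \<Longrightarrow> b \<simeq> c \<Longrightarrow> a \<simeq> c"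
  using complex_vector.subspace_add[OF subspace, of "a - b" "b - c"] by (simp add: cong_def)

lemma cong_add: "a \<simeq> b \<Longrightarrow> c \<simeq> d \<Longrightarrow> a + c \<simeq> b + d"
  using complex_vector.subspace_add[OF subspace, of "a - b" "c - d"]
  by (simp add: cong_def algebra_simps)

lemma cong_diff: "a \<simeq> b \<Longrightarrow> c \<simeq> d \<Longrightarrow> a - c \<simeq> b - d"
  using complex_vector.subspace_diff[OF subspace, of "a - b" "c - d"]
  by (simp add: cong_def algebra_simps)

lemma cong_scaleC: "a \<simeq> b \<Longrightarrow> z *\<^sub>C a \<simeq> z *\<^sub>C b"
  using complex_vector.subspace_scale[OF subspace, of "a - b" z]
  by (simp add: cong_def complex_vector.scale_right_diff_distrib)

lemma cong_mult: "a \<simeq> b \<Longrightarrow> c \<simeq> d \<Longrightarrow> a * c \<simeq> b * d"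
  using complex_vector.subspace_add[OF subspace absorb_right[of "a - b" c] absorb_left[of "c - d" b]]
  by (simp add: cong_def algebra_simps)

lemma cong_commute: "a * b \<simeq> b * a"
  by (simp add: cong_def commutator)

lemma left_unit: "u * a \<simeq> a"
  using cong_commute[of u a] by simp

lemma cong_0_iff: "a \<simeq> 0 \<longleftrightarrow> a \<in> M"
  by (simp add: cong_def)

lemma mult_notin: "a \<notin> M \<Longrightarrow> b \<notin> M \<Longrightarrow> a * b \<notin> M"
proof
  assume "a \<notin> M" "b \<notin> M" "a * b \<in> M"
  then obtain p where "p * a \<simeq> u"
    using invertible by (auto simp: cong_def)
  then have "p * a * b \<simeq> u * b"
    by (intro cong_mult) auto
  also have "u * b \<simeq> b"
    by (rule left_unit)
  finally have "b \<simeq> p * (a * b)"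
    by (simp add: cong_sym mult.assoc)
  also have "\<dots> \<simeq> 0"
    using absorb_left[OF \<open>a * b \<in> M\<close>] by (simp add: cong_0_iff)
  finally show False
    using \<open>b \<notin> M\<close> by (simp add: cong_0_iff)
qed

text \<open>
  An element \<open>b\<close> with \<open>b * (u - w) \<simeq> u\<close> represents \<open>(1 - w)\<^sup>-\<^sup>1\<close> in the quotient; this is the
  usual formula for the difference of two such inverses.
\<close>

lemma resolvent_identity:
  assumes "b * (u - w) \<simeq> u" and "b' * (u - w') \<simeq> u"
  shows "b - b' \<simeq> b * b' * (w - w')"
proof -
  have "b * (b' * (u - w')) \<simeq> b * u"
    using assms(2) by (intro cong_mult) auto
  moreover have "b * (b' * (u - w)) \<simeq> b'"
  proof -
    have "b * (b' * (u - w)) \<simeq> b * ((u - w) * b')"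
      by (intro cong_mult cong_commute cong_refl)
    also have "\<dots> = (b * (u - w)) * b'"
      by (simp add: mult.assoc)
    also have "\<dots> \<simeq> u * b'"
      using assms(1) by (intro cong_mult) auto
    also have "\<dots> \<simeq> b'"
      by (rule left_unit)
    finally show ?thesis .
  qed
  ultimately have "b * (b' * (u - w')) - b * (b' * (u - w)) \<simeq> b * u - b'"
    by (rule cong_diff)
  moreover have "b * b' * (w - w') = b * (b' * (u - w')) - b * (b' * (u - w))"
    by (simp add: algebra_simps)
  ultimately show ?thesis
    by (simp add: cong_sym)
qed

lemma resolvent_unique:
  assumes "b * (u - w) \<simeq> u" and "b' * (u - w) \<simeq> u"
  shows "b \<simeq> b'"
  using resolvent_identity[OF assms] by (simp add: cong_def)

text \<open>
  The partial fraction decomposition \<open>2 / (1 - w\<^sup>2) = 1 / (1 - w) + 1 / (1 + w)\<close>.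
\<close>

lemma resolvent_square:
  assumes "b * (u - w) \<simeq> u" and "c * (u + w) \<simeq> u" and "e * (u - w * w) \<simeq> u"
  shows "e + e \<simeq> b + c"
proof -
  have diff: "(u + w) * (u - w) \<simeq> u - w * w" and diff': "(u - w) * (u + w) \<simeq> u - w * w"
    using left_unit[of w] complex_vector.subspace_neg[OF subspace, of "u * w - w"]
    by (simp_all add: cong_def algebra_simps)
  have "e * (u + w) * (u - w) \<simeq> u" "e * (u - w) * (u - (- w)) \<simeq> u"
    using cong_trans[OF cong_mult[OF cong_refl diff] assms(3)]
      cong_trans[OF cong_mult[OF cong_refl diff'] assms(3)] by (simp_all add: mult.assoc)
  then have "e * (u + w) \<simeq> b" "e * (u - w) \<simeq> c"
    using assms(1,2) by (auto intro: resolvent_unique[of _ w] resolvent_unique[of _ "- w"])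
  then have "e * (u + w) + e * (u - w) \<simeq> b + c"
    by (rule cong_add)
  then show ?thesis
    by (simp add: algebra_simps)
qed

definition qnorm :: "'a \<Rightarrow> real" where
  "qnorm a = infdist a M"

lemma M_nonempty: "M \<noteq> {}"
  using complex_vector.subspace_0[OF subspace] by auto

lemma qnorm_nonneg [simp]: "qnorm a \<ge> 0"
  by (simp add: qnorm_def infdist_nonneg)

lemma qnorm_eq_0_iff: "qnorm a = 0 \<longleftrightarrow> a \<simeq> 0"
  using in_closed_iff_infdist_zero[OF closed M_nonempty] by (simp add: qnorm_def cong_0_iff)

lemma qnorm_le: "a \<simeq> b \<Longrightarrow> qnorm a \<le> norm b"
  using infdist_le[of "a - b" M a] by (simp add: qnorm_def cong_def dist_norm)

lemma qnorm_approx: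
  assumes "qnorm a < r"
  obtains b where "a \<simeq> b" "norm b < r"
proof -
  obtain m where "m \<in> M" "dist a m < r"
    using assms M_nonempty cINF_less_iff[of M "dist a" r] bdd_belowI2[of M 0 "dist a"]
    by (auto simp: qnorm_def infdist_notempty)
  then show ?thesis
    by (intro that[of "a - m"]) (auto simp: cong_def dist_norm)
qed

lemma qnorm_add: "qnorm (a + b) \<le> qnorm a + qnorm b"
proof (rule field_le_epsilon)
  fix e :: real assume "e > 0"
  obtain a' b' where "a \<simeq> a'" "norm a' < qnorm a + e / 2" "b \<simeq> b'" "norm b' < qnorm b + e / 2"
    using \<open>e > 0\<close> by (metis qnorm_approx half_gt_zero less_add_same_cancel1)
  then show "qnorm (a + b) \<le> qnorm a + qnorm b + e"
    using qnorm_le[OF cong_add, of a a' b b'] norm_triangle_ineq[of a' b'] by linarith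
qed

lemma qnorm_mult: "qnorm (a * b) \<le> qnorm a * qnorm b"
proof -
  have "qnorm (a * b) \<le> (qnorm a + e) * (qnorm b + e)" if "e > 0" for e
  proof -
    obtain a' b' where "a \<simeq> a'" "norm a' < qnorm a + e" "b \<simeq> b'" "norm b' < qnorm b + e"
      using \<open>e > 0\<close> by (metis qnorm_approx less_add_same_cancel1)
    then have "qnorm (a * b) \<le> norm (a' * b')"
      by (intro qnorm_le cong_mult)
    moreover have "norm a' * norm b' \<le> (qnorm a + e) * (qnorm b + e)"
      using \<open>norm a' < qnorm a + e\<close> \<open>norm b' < qnorm b + e\<close> that by (intro mult_mono) auto
    ultimately show ?thesis
      using norm_mult_ineq[of a' b'] by linarith
  qed
  then have "eventually (\<lambda>e. qnorm (a * b) \<le> (qnorm a + e) * (qnorm b + e)) (at_right 0)"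
    by (auto simp: eventually_at_right_less eventually_at_filter)
  moreover have "((\<lambda>e. (qnorm a + e) * (qnorm b + e)) \<longlongrightarrow> (qnorm a + 0) * (qnorm b + 0)) (at_right 0)"
    by (intro tendsto_intros)
  ultimately show ?thesis
    using tendsto_lowerbound[of _ _ "at_right (0::real)"] by fastforce
qed

lemma qnorm_scaleC: "qnorm (z *\<^sub>C a) \<le> cmod z * qnorm a"
proof (cases "z = 0")
  case True
  then show ?thesis
    using qnorm_eq_0_iff[of "z *\<^sub>C a"] by simp
next
  case False
  show ?thesis
  proof (rule field_le_epsilon)
    fix e :: real assume "e > 0"
    then have "qnorm a < qnorm a + e / cmod z"
      using False by simp
    then obtain a' where "a \<simeq> a'" "norm a' < qnorm a + e / cmod z"
      by (rule qnorm_approx)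
    then have "qnorm (z *\<^sub>C a) \<le> cmod z * norm a'" "cmod z * norm a' \<le> cmod z * (qnorm a + e / cmod z)"
      using qnorm_le[OF cong_scaleC, of a a' z] by (auto simp: norm_scaleC intro: mult_left_mono)
    then show "qnorm (z *\<^sub>C a) \<le> cmod z * qnorm a + e"
      using False by (simp add: distrib_left)
  qed
qed

lemma qnorm_cong: "a \<simeq> b \<Longrightarrow> qnorm a = qnorm b"
proof -
  have "qnorm a \<le> qnorm b" if "a \<simeq> b" for a b
    using qnorm_add[of "a - b" b] qnorm_eq_0_iff[of "a - b"] that by (simp add: cong_def)
  then show "a \<simeq> b \<Longrightarrow> qnorm a = qnorm b"
    using cong_sym by (meson antisym)
qed

lemma qnorm_minus: "qnorm (a - b) = qnorm (b - a)"
proof -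
  have "qnorm (- c) \<le> qnorm c" for c
    using qnorm_scaleC[of "-1" c] by simp
  from this[of "a - b"] this[of "b - a"] show ?thesis
    by simp
qed

lemma qnorm_u: "qnorm u \<ge> 1"
proof -
  have "qnorm u > 0"
    using qnorm_eq_0_iff[of u] proper qnorm_nonneg[of u] by (simp add: cong_0_iff order_less_le)
  moreover have "qnorm u \<le> qnorm u * qnorm u"
    using qnorm_mult[of u u] by simp
  ultimately show ?thesis by simp
qed

text \<open>
  A representative of \<open>(1 - w)\<^sup>-\<^sup>1\<close> in the quotient.
\<close>

definition h :: "'a \<Rightarrow> 'a" where
  "h w = (SOME b. b * (u - w) \<simeq> u)"

text \<open>
  The elements whose class has no nonzero complex number in its spectrum.
\<close>

definition regular :: "'a \<Rightarrow> bool" where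
  "regular w \<longleftrightarrow> (\<forall>z. u - z *\<^sub>C w \<notin> M)"

lemma h: "regular w \<Longrightarrow> h (z *\<^sub>C w) * (u - z *\<^sub>C w) \<simeq> u"
  unfolding h_def by (rule someI_ex) (use invertible in \<open>auto simp: regular_def cong_def\<close>)

lemma scaleC_mult_scaleC: "(z *\<^sub>C a) * (z' *\<^sub>C b) = (z * z') *\<^sub>C (a * b)" for a b :: 'a
  by (simp add: mult_scaleC_left mult_scaleC_right scaleC_scaleC mult.commute)

lemma csqrt_scaleC_square: "(csqrt z *\<^sub>C a) * (csqrt z *\<^sub>C a) = z *\<^sub>C (a * a)" for a :: 'a
  by (simp add: scaleC_mult_scaleC flip: power2_eq_square)

lemma regular_square: "regular w \<Longrightarrow> regular (w * w)"
  unfolding regular_def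
proof
  fix z assume reg: "\<forall>z. u - z *\<^sub>C w \<notin> M"
  define v where "v = csqrt z *\<^sub>C w"
  have "u - v \<notin> M" "u + v \<notin> M"
    using reg[rule_format, of "csqrt z"] reg[rule_format, of "- csqrt z"] by (auto simp: v_def)
  then have "(u + v) * (u - v) \<notin> M"
    by (intro mult_notin)
  moreover have "(u + v) * (u - v) \<simeq> u - v * v"
    using left_unit[of v] complex_vector.subspace_neg[OF subspace, of "u * v - v"]
    by (simp add: cong_def algebra_simps)
  ultimately have "u - v * v \<notin> M"
    using cong_trans by (auto simp flip: cong_0_iff)
  then show "u - z *\<^sub>C (w * w) \<notin> M"
    by (simp add: v_def csqrt_scaleC_square)
qed

lemma h_square:
  assumes "regular w"
  shows "h (z *\<^sub>C (w * w)) \<simeq>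
    (1/2) *\<^sub>C (h (csqrt z *\<^sub>C w) + h ((- csqrt z) *\<^sub>C w))"
proof -
  define e where "e = h (z *\<^sub>C (w * w))"
  have "e + e \<simeq> h (csqrt z *\<^sub>C w) + h ((- csqrt z) *\<^sub>C w)"
  proof (rule resolvent_square)
    show "h (csqrt z *\<^sub>C w) * (u - csqrt z *\<^sub>C w) \<simeq> u"
      using assms by (rule h)
    show "h ((- csqrt z) *\<^sub>C w) * (u + csqrt z *\<^sub>C w) \<simeq> u"
      using h[OF assms, of "- csqrt z"] by simp
    show "e * (u - (csqrt z *\<^sub>C w) * (csqrt z *\<^sub>C w)) \<simeq> u"
      using h[OF regular_square[OF assms], of z] by (simp only: e_def csqrt_scaleC_square)
  qed
  then have "(1/2) *\<^sub>C (e + e) \<simeq> (1/2) *\<^sub>C (h (csqrt z *\<^sub>C w) + h ((- csqrt z) *\<^sub>C w))"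
    by (rule cong_scaleC)
  moreover have "(1/2) *\<^sub>C (e + e) = e"
    using scaleC_add_left[of "1/2" "1/2" e] by (simp add: scaleC_add_right)
  ultimately show ?thesis
    by (simp add: e_def)
qed

text \<open>
  The step which replaces the maximum principle: by partial fractions, \<open>h\<close> at \<open>z w\<^sup>2\<close> is the mean of
  its values at \<open>\<zeta> w\<close> and \<open>- \<zeta> w\<close> with \<open>\<zeta>\<^sup>2 = z\<close>. Hence a bound for the differences of \<open>h\<close> on
  the two circles through \<open>v\<close> and \<open>w\<close> passes to the circles through their squares.
\<close>

lemma h_square_diff:
  assumes "regular v" "regular w" and "cmod z = 1"
    and "\<And>z. cmod z = 1 \<Longrightarrow> qnorm (h (z *\<^sub>C v) - h (z *\<^sub>C w)) \<le> \<epsilon>"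
  shows "qnorm (h (z *\<^sub>C (v * v)) - h (z *\<^sub>C (w * w))) \<le> \<epsilon>"
proof -
  define s where "s = csqrt z"
  have [simp]: "cmod s = 1" "cmod (- s) = 1"
    using assms(3) by (simp_all add: s_def)
  let ?d = "\<lambda>z. h (z *\<^sub>C v) - h (z *\<^sub>C w)"
  have "h (z *\<^sub>C (v * v)) - h (z *\<^sub>C (w * w))
      \<simeq> (1/2) *\<^sub>C (h (s *\<^sub>C v) + h ((- s) *\<^sub>C v)) - (1/2) *\<^sub>C (h (s *\<^sub>C w) + h ((- s) *\<^sub>C w))"
    unfolding s_def by (intro cong_diff h_square assms)
  also have "\<dots> = (1/2) *\<^sub>C (?d s + ?d (- s))"
    by (simp add: algebra_simps complex_vector.scale_right_diff_distrib scaleC_add_right)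
  finally have "qnorm (h (z *\<^sub>C (v * v)) - h (z *\<^sub>C (w * w))) = qnorm ((1/2) *\<^sub>C (?d s + ?d (- s)))"
    by (rule qnorm_cong)
  also have "\<dots> \<le> (qnorm (?d s) + qnorm (?d (- s))) / 2"
    using qnorm_scaleC[of "1/2" "?d s + ?d (- s)"] qnorm_add[of "?d s" "?d (- s)"] by simp
  also have "\<dots> \<le> \<epsilon>"
    using assms(4)[of s] assms(4)[of "- s"] by simp
  finally show ?thesis .
qed

definition square_iter :: "nat \<Rightarrow> 'a \<Rightarrow> 'a" where
  "square_iter k = ((\<lambda>w. w * w) ^^ k)"

lemma square_iter_0 [simp]: "square_iter 0 w = w"
  and square_iter_Suc [simp]: "square_iter (Suc k) w = square_iter k w * square_iter k w"
  by (simp_all add: square_iter_def)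

lemma square_iter_add: "square_iter (j + k) w = square_iter j (square_iter k w)"
  by (simp add: square_iter_def funpow_add)

lemma regular_square_iter: "regular w \<Longrightarrow> regular (square_iter k w)"
  by (induction k) (auto intro: regular_square)

lemma h_square_iter_diff:
  assumes "regular v" "regular w" and "cmod z = 1"
    and "\<And>z. cmod z = 1 \<Longrightarrow> qnorm (h (z *\<^sub>C v) - h (z *\<^sub>C w)) \<le> \<epsilon>"
  shows "qnorm (h (z *\<^sub>C square_iter k v) - h (z *\<^sub>C square_iter k w)) \<le> \<epsilon>"
  using assms(3)
proof (induction k arbitrary: z)
  case (Suc k)
  then show ?case
    unfolding square_iter_Suc by (intro h_square_diff regular_square_iter assms)
qed (simp add: assms(4))

text \<open>
  Squaring contracts as soon as the quotient norm is at most one half; the exponent given here is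
  far from sharp but enough to reach every positive threshold.
\<close>

lemma qnorm_square_iter_le_half:
  assumes "qnorm w \<le> 1/2"
  shows "qnorm (square_iter j w) \<le> (1/2) ^ Suc j"
proof (induction j)
  case (Suc j)
  have "qnorm (square_iter (Suc j) w) \<le> (1/2) ^ Suc j * (1/2) ^ Suc j"
    using qnorm_mult[of "square_iter j w" "square_iter j w"] mult_mono[OF Suc Suc] by auto
  also have "\<dots> \<le> (1/2) * (1/2) ^ Suc j"
    by (intro mult_right_mono) (auto simp: power_le_one)
  finally show ?case by simp
qed (use assms in simp)

text \<open>
  The resolvent identity makes \<open>s \<mapsto> qnorm (h (s x))\<close> continuous, hence bounded on discs, and then yields a
  Lipschitz estimate there.
\<close>

lemma h_lipschitz:
  assumes "regular x"
  obtains L where "L \<ge> 0" and "\<And>s t. cmod s \<le> R \<Longrightarrow> cmod t \<le> R \<Longrightarrow>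
    qnorm (h (s *\<^sub>C x) - h (t *\<^sub>C x)) \<le> L * cmod (s - t)"
proof -
  define f where "f s = qnorm (h (s *\<^sub>C x))" for s
  have ident: "qnorm (h (s *\<^sub>C x) - h (t *\<^sub>C x)) \<le> f s * f t * qnorm x * cmod (s - t)" for s t
  proof -
    have "qnorm (h (s *\<^sub>C x) - h (t *\<^sub>C x)) = qnorm (h (s *\<^sub>C x) * h (t *\<^sub>C x) * ((s - t) *\<^sub>C x))"
      using qnorm_cong[OF resolvent_identity[OF h[OF assms, of s] h[OF assms, of t]]]
      by (simp add: complex_vector.scale_left_diff_distrib)
    also have "\<dots> \<le> qnorm (h (s *\<^sub>C x) * h (t *\<^sub>C x)) * qnorm ((s - t) *\<^sub>C x)"
      by (rule qnorm_mult)
    also have "\<dots> \<le> (f s * f t) * (cmod (s - t) * qnorm x)"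
      unfolding f_def by (intro mult_mono qnorm_mult qnorm_scaleC) auto
    finally show ?thesis
      by (simp add: mult_ac)
  qed
  have diff: "f s \<le> f t + f s * f t * qnorm x * cmod (s - t)" for s t
    using ident[of s t] qnorm_add[of "h (s *\<^sub>C x) - h (t *\<^sub>C x)" "h (t *\<^sub>C x)"]
    by (simp add: f_def)
  have f0: "f s \<ge> 0" for s
    by (simp add: f_def)
  have "isCont f s" for s
    unfolding isCont_def LIM_eq
  proof (intro allI impI)
    fix e :: real assume "e > 0"
    define k where "k = f s * qnorm x"
    have "k \<ge> 0"
      using f0 by (simp add: k_def)
    \<comment> \<open>The first bound on the radius gives \<open>f t \<le> 2 * f s\<close>, the second then makes the difference small.\<close>
    define r where "r = min (1 / (2 * (k + 1))) (e / (2 * (k * f s + 1)))"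
    have pos: "k + 1 > 0" "k * f s + 1 > 0"
      using \<open>k \<ge> 0\<close> f0[of s] by (auto intro: add_nonneg_pos)
    then have "r > 0"
      using \<open>e > 0\<close> by (simp add: r_def)
    moreover have "norm (f t - f s) < e" if "norm (t - s) < r" for t
    proof -
      let ?c = "cmod (t - s)"
      have "?c * (2 * (k + 1)) < 1" "?c * (2 * (k * f s + 1)) < e"
        using that pos by (auto simp: r_def field_simps)
      then have c: "k * ?c \<le> 1/2" "2 * (k * f s * ?c) < e"
        by (simp_all add: algebra_simps) (smt (verit) norm_ge_zero)+
      have "f t \<le> f s + f t * (k * ?c)" "f s \<le> f t + f t * (k * ?c)"
        using diff[of t s] diff[of s t] by (simp_all add: k_def mult_ac norm_minus_commute)
      moreover have "f t * (k * ?c) \<le> f t * (1/2)"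
        using c(1) f0 by (intro mult_left_mono)
      ultimately have "f t \<le> 2 * f s" "\<bar>f t - f s\<bar> \<le> f t * (k * ?c)"
        by auto
      moreover have "f t * (k * ?c) \<le> 2 * f s * (k * ?c)"
        using \<open>f t \<le> 2 * f s\<close> \<open>k \<ge> 0\<close> by (intro mult_right_mono) auto
      ultimately show ?thesis
        using c(2) by (simp add: mult_ac)
    qed
    ultimately show "\<exists>r>0. \<forall>t. t \<noteq> s \<and> norm (t - s) < r \<longrightarrow> norm (f t - f s) < e"
      by blast
  qed
  then have "continuous_on (cball 0 R) f"
    by (simp add: continuous_at_imp_continuous_on)
  then obtain B where B: "B \<ge> 0" "\<And>s. s \<in> cball 0 R \<Longrightarrow> norm (f s) \<le> B"
    using continuous_on_compact_bound[OF compact_cball] by metis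
  show ?thesis
  proof (rule that[of "B * B * qnorm x"])
    show "B * B * qnorm x \<ge> 0"
      by simp
    fix s t assume "cmod s \<le> R" "cmod t \<le> R"
    then have "f s * f t * qnorm x * cmod (s - t) \<le> B * B * qnorm x * cmod (s - t)"
      using B f0 by (intro mult_right_mono mult_mono) (auto simp: dist_norm)
    then show "qnorm (h (s *\<^sub>C x) - h (t *\<^sub>C x)) \<le> B * B * qnorm x * cmod (s - t)"
      using ident[of s t] by linarith
  qed
qed

text \<open>
  If \<open>w\<close> is small then \<open>(1 - w)\<^sup>-\<^sup>1\<close> is close to 1. If \<open>(1 - w')\<^sup>-\<^sup>1\<close> is close to it, then it is
  close to 1 as well, and inverting shows that \<open>w'\<close> is not large. The constants are chosen so that
  the two errors are \<open>1/6\<close> each, and an inverse within \<open>1/3\<close> of 1 forces \<open>qnorm w' \<le> 1/2\<close>. The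
  threshold involves \<open>qnorm u\<close> because the norm of the unit may exceed 1.
\<close>

lemma qnorm_le_half_transfer:
  assumes w: "b * (u - w) \<simeq> u" "qnorm w \<le> 1 / (8 * qnorm u)"
    and w': "b' * (u - w') \<simeq> u" "qnorm (b - b') \<le> 1/6"
  shows "qnorm w' \<le> 1/2"
proof -
  let ?c = "1 / (8 * qnorm u)"
  have c: "?c \<le> 1/8" "?c * qnorm u = 1/8" "?c \<ge> 0"
    using qnorm_u by (auto simp: field_simps)
  have "b - u \<simeq> b * w"
    using w(1) by (simp add: cong_def algebra_simps)
  then have "qnorm (b - u) \<le> qnorm b * qnorm w"
    using qnorm_mult[of b w] by (simp add: qnorm_cong)
  also have "\<dots> \<le> (qnorm (b - u) + qnorm u) * ?c"
    using w(2) qnorm_add[of "b - u" u] by (intro mult_mono) auto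
  also have "\<dots> = qnorm (b - u) * ?c + 1/8"
    using c(2) by (simp only: distrib_right mult.commute)
  also have "\<dots> \<le> qnorm (b - u) * (1/8) + 1/8"
    using c by (intro add_right_mono mult_left_mono) auto
  finally have "qnorm (b - u) \<le> 1/6"
    by simp
  define v where "v = b' - u"
  have "v = (b' - b) + (b - u)"
    by (simp add: v_def)
  then have v: "qnorm v \<le> 1/3"
    using qnorm_add[of "b' - b" "b - u"] w'(2) \<open>qnorm (b - u) \<le> 1/6\<close> qnorm_minus[of b b'] by simp
  have "w' \<simeq> v - v * w'"
  proof -
    have "v - v * w' - u * w' \<simeq> 0"
      using w'(1) by (simp add: cong_def v_def algebra_simps)
    then have "v - v * w' - u * w' + u * w' \<simeq> 0 + w'"
      by (intro cong_add left_unit)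
    then show ?thesis
      by (simp add: cong_sym)
  qed
  then have "qnorm w' = qnorm (v - v * w')"
    by (rule qnorm_cong)
  also have "\<dots> \<le> qnorm v + qnorm (v * w')"
    using qnorm_add[of v "0 - v * w'"] qnorm_minus[of "v * w'" 0] by simp
  also have "\<dots> \<le> 1/3 + 1/3 * qnorm w'"
    using v qnorm_mult[of v w'] mult_right_mono[OF v, of "qnorm w'"] by simp
  finally show ?thesis
    by simp
qed

text \<open>
  The Gelfand-Mazur theorem, by an argument in the spirit of Rickart that needs neither functionals
  nor contour integrals. Suppose \<open>x\<close> has empty spectrum. Say that a radius \<open>t\<close> is good if the
  iterated squares of \<open>t x\<close> reach a fixed small threshold. Radius 0 is good. The Lipschitz bound for \<open>h\<close>
  is inherited by all iterated squares, so goodness spreads from \<open>t\<close> to \<open>t + \<delta>\<close> with a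
  step \<open>\<delta>\<close> that is uniform on \<open>[0, R]\<close>. Hence \<open>R\<close> is good for every \<open>R\<close>. But \<open>x\<close> has an
  inverse \<open>y\<close>, and once \<open>R \<ge> qnorm y\<close> the powers of \<open>R x\<close> cannot get small, since those of \<open>y / R\<close>
  stay bounded.
\<close>

lemma spectrum_nonempty: "\<exists>z. x - z *\<^sub>C u \<in> M"
proof (rule ccontr)
  assume "\<nexists>z. x - z *\<^sub>C u \<in> M"
  then have no_spectrum: "x - z *\<^sub>C u \<notin> M" for z
    by blast
  have "regular x"
    unfolding regular_def
  proof (intro allI notI)
    fix z assume z: "u - z *\<^sub>C x \<in> M"
    then have "z \<noteq> 0"
      using proper by auto
    then have "(- inverse z) *\<^sub>C (u - z *\<^sub>C x) = x - inverse z *\<^sub>C u"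
      by (simp add: complex_vector.scale_right_diff_distrib scaleC_scaleC)
    then show False
      using no_spectrum complex_vector.subspace_scale[OF subspace z, of "- inverse z"] by metis
  qed
  have reg: "regular (z *\<^sub>C x)" for z
    using \<open>regular x\<close> by (simp add: regular_def scaleC_scaleC)
  have "x \<notin> M"
    using no_spectrum[of 0] by simp
  then obtain y where y: "y * x \<simeq> u"
    using invertible by (auto simp: cong_def)
  define R where "R = qnorm y + 1"
  have "R > 0"
    by (simp add: R_def add_nonneg_pos)
  obtain L where "L \<ge> 0" and L: "\<And>s t. cmod s \<le> R \<Longrightarrow> cmod t \<le> R \<Longrightarrow>
      qnorm (h (s *\<^sub>C x) - h (t *\<^sub>C x)) \<le> L * cmod (s - t)"
    using h_lipschitz[OF \<open>regular x\<close>] by blast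
  \<comment> \<open>Moving \<open>t\<close> by \<open>R / m\<close> changes \<open>h\<close> by at most \<open>1/6\<close>.\<close>
  obtain m :: nat where "6 * L * R < real m"
    using reals_Archimedean2 by blast
  moreover have "0 \<le> 6 * L * R"
    using \<open>L \<ge> 0\<close> \<open>R > 0\<close> by simp
  ultimately have m: "m > 0" "6 * L * R \<le> real m"
    by (auto intro: gr0I)
  define t where "t n = real n * (R / real m)" for n
  have good: "\<exists>k. qnorm (square_iter k (complex_of_real (t n) *\<^sub>C x)) \<le> 1 / (8 * qnorm u)"
    if "n \<le> m" for n
    using that
  proof (induction n)
    case 0
    have "qnorm (0 *\<^sub>C x) = 0"
      by (simp add: qnorm_eq_0_iff)
    then show ?case
      using qnorm_u by (intro exI[of _ 0]) (simp add: t_def)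
  next
    case (Suc n)
    let ?v = "complex_of_real (t n) *\<^sub>C x" and ?w = "complex_of_real (t (Suc n)) *\<^sub>C x"
    obtain k where k: "qnorm (square_iter k ?v) \<le> 1 / (8 * qnorm u)"
      using Suc by auto
    have t: "0 \<le> t n" "t n \<le> R" "0 \<le> t (Suc n)" "t (Suc n) \<le> R"
      and step: "t (Suc n) - t n = R / real m"
      using \<open>R > 0\<close> m mult_right_mono[of "real (Suc n)" "real m" R] Suc.prems
      by (auto simp: t_def field_simps)
    have "qnorm (h (z *\<^sub>C ?v) - h (z *\<^sub>C ?w)) \<le> 1/6" if "cmod z = 1" for z
    proof -
      have "qnorm (h ((z * t n) *\<^sub>C x) - h ((z * t (Suc n)) *\<^sub>C x)) \<le> L * cmod (z * t n - z * t (Suc n))"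
        using t that by (intro L) (auto simp: norm_mult)
      also have "cmod (z * t n - z * t (Suc n)) = R / real m"
      proof -
        have "cmod (z * t n - z * t (Suc n)) = cmod z * cmod (complex_of_real (t n - t (Suc n)))"
          by (simp add: algebra_simps flip: norm_mult)
        also have "\<dots> = R / real m"
          using that step \<open>R > 0\<close> m by (simp add: norm_of_real abs_minus_commute[of "t n"] del: of_real_diff)
        finally show ?thesis .
      qed
      also have "L * (R / real m) \<le> 1/6"
        using m by (simp add: field_simps)
      finally show ?thesis
        by (simp add: scaleC_scaleC)
    qed
    then have "qnorm (h (1 *\<^sub>C square_iter k ?v) - h (1 *\<^sub>C square_iter k ?w)) \<le> 1/6"
      by (intro h_square_iter_diff reg) auto
    then have "qnorm (square_iter k ?w) \<le> 1/2"
      using k h[OF regular_square_iter[OF reg], of 1] by (intro qnorm_le_half_transfer) auto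
    moreover obtain j where "(1/2) ^ j < 1 / (8 * qnorm u)"
      using real_arch_pow_inv[of "1 / (8 * qnorm u)" "1/2"] qnorm_u by auto
    moreover have "(1/2::real) ^ Suc j \<le> (1/2) ^ j"
      by simp
    ultimately have "qnorm (square_iter (j + k) ?w) \<le> 1 / (8 * qnorm u)"
      using qnorm_square_iter_le_half[of "square_iter k ?w" j] unfolding square_iter_add by linarith
    then show ?case
      by blast
  qed
  define x' y' where "x' = complex_of_real R *\<^sub>C x" and "y' = complex_of_real (1 / R) *\<^sub>C y"
  obtain k where k: "qnorm (square_iter k x') \<le> 1 / (8 * qnorm u)"
    using good[of m] m by (auto simp: t_def x'_def)
  have inverse: "square_iter j y' * square_iter j x' \<simeq> u" for j
  proof (induction j)
    case 0
    then show ?case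
      using y \<open>R > 0\<close> by (simp add: x'_def y'_def scaleC_mult_scaleC flip: of_real_mult)
  next
    case (Suc j)
    let ?X = "square_iter j x'" and ?Y = "square_iter j y'"
    have "?Y * (?Y * ?X) * ?X \<simeq> ?Y * u * ?X"
      using Suc by (intro cong_mult) auto
    also have "?Y * u * ?X = ?Y * ?X"
      by simp
    also have "\<dots> \<simeq> u"
      by (rule Suc)
    finally show ?case
      by (simp add: mult.assoc)
  qed
  have small: "qnorm (square_iter j y') \<le> 1" for j
  proof (induction j)
    case 0
    have "qnorm y' \<le> (1 / R) * qnorm y"
      using qnorm_scaleC[of "complex_of_real (1 / R)" y] \<open>R > 0\<close> by (simp only: y'_def norm_of_real) simp
    also have "\<dots> \<le> 1"
      using \<open>R > 0\<close> by (simp add: R_def field_simps)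
    finally show ?case
      by simp
  next
    case (Suc j)
    then show ?case
      using qnorm_mult[of "square_iter j y'" "square_iter j y'"] mult_mono[OF Suc Suc] by simp
  qed
  have "qnorm u \<le> qnorm (square_iter k y') * qnorm (square_iter k x')"
    using qnorm_mult[of "square_iter k y'" "square_iter k x'"] qnorm_cong[OF inverse[of k]] by simp
  also have "\<dots> \<le> 1 * (1 / (8 * qnorm u))"
    using small k by (intro mult_mono) auto
  also have "\<dots> \<le> 1/8"
    using qnorm_u by (simp add: field_simps)
  finally show False
    using qnorm_u by simp
qed

end

section \<open>Characters and semisimplicity\<close>

text \<open>
  A substitute for the Neumann series in an algebra without unit: \<open>y\<close> plays the role of
  \<open>(1 - v)\<^sup>-\<^sup>1 w\<close>.
\<close>

lemma contraction_fixpoint: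
  fixes v :: "'a::complex_banach_algebra"
  assumes "norm v < 1"
  obtains y where "y = w + v * y"
proof -
  have "\<exists>!y. w + v * y = y"
    by (rule banach_fix_type[of "norm v"])
      (use assms in \<open>auto simp: dist_norm norm_mult_ineq simp flip: right_diff_distrib\<close>)
  then show ?thesis
    using that by metis
qed

definition character :: "('a::complex_banach_algebra \<Rightarrow> complex) \<Rightarrow> bool" where
  "character \<phi> \<longleftrightarrow> (\<forall>x y. \<phi> (x + y) = \<phi> x + \<phi> y) \<and> (\<forall>z x. \<phi> (z *\<^sub>C x) = z * \<phi> x) \<and>
     (\<forall>x y. \<phi> (x * y) = \<phi> x * \<phi> y) \<and> (\<exists>x. \<phi> x \<noteq> 0)"

lemma
  assumes "character \<phi>"
  shows character_add: "\<phi> (x + y) = \<phi> x + \<phi> y"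
    and character_scaleC: "\<phi> (z *\<^sub>C x) = z * \<phi> x"
    and character_mult: "\<phi> (x * y) = \<phi> x * \<phi> y"
    and character_nonzero: "\<exists>x. \<phi> x \<noteq> 0"
  using assms by (auto simp: character_def)

text \<open>
  Characters are automatically continuous: if \<open>\<phi> v = 1\<close> and \<open>norm v < 1\<close>, applying \<open>\<phi>\<close> to a
  solution of \<open>y = v + v * y\<close> gives \<open>\<phi> y = 1 + \<phi> y\<close>.
\<close>

lemma character_norm_le:
  assumes "character \<phi>"
  shows "cmod (\<phi> x) \<le> norm x"
proof (rule ccontr)
  assume "\<not> cmod (\<phi> x) \<le> norm x"
  then have less: "norm x < cmod (\<phi> x)"
    by simp
  then have "\<phi> x \<noteq> 0"
    using norm_ge_zero[of x] by auto
  define v where "v = inverse (\<phi> x) *\<^sub>C x"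
  have "norm v = norm x / cmod (\<phi> x)"
    by (simp add: v_def norm_scaleC norm_inverse divide_inverse mult.commute)
  then have "norm v < 1"
    using less by (simp add: divide_less_eq)
  then obtain y where "y = v + v * y"
    by (rule contraction_fixpoint)
  then have "\<phi> y = \<phi> v + \<phi> v * \<phi> y"
    by (metis assms character_add character_mult)
  then show False
    using \<open>\<phi> x \<noteq> 0\<close> assms by (simp add: v_def character_scaleC)
qed

lemma bounded_linear_character:
  assumes "character \<phi>"
  shows "bounded_linear \<phi>"
proof (rule bounded_linear_intro[of _ 1])
  fix r x
  show "\<phi> (r *\<^sub>R x) = r *\<^sub>R \<phi> x"
    using character_scaleC[OF assms, of "complex_of_real r" x]
    by (simp add: scaleC_of_real scaleR_conv_of_real)
qed (simp_all add: assms character_add character_norm_le)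

lemma character_diff: "character \<phi> \<Longrightarrow> \<phi> (x - y) = \<phi> x - \<phi> y"
  and character_zero: "character \<phi> \<Longrightarrow> \<phi> 0 = 0"
  using bounded_linear_character[THEN bounded_linear.linear] linear_diff linear_0 by blast+

text \<open>
  Everything takes place in \<open>A\<close> itself and not in its subalgebra \<open>uA\<close>. As \<open>r = 0\<close> in
  \<open>A / ran(A)\<close> iff \<open>u * r = 0\<close>, and this quotient is a copy of \<open>uA\<close>, equations in \<open>uA\<close>
  become equations in \<open>A\<close> after multiplication by \<open>u\<close> from the left.
\<close>

locale right_unital_semisimple =
  fixes u :: "'a::complex_banach_algebra"
  assumes right_unit [simp]: "a * u = a"
    and commut: "commutative {u * a | a. True}"
    and semisimp: "semisimple {u * a | a. True}"
begin

definition B :: "'a set" where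
  "B = {u * a | a. True}"

lemma mult_u_assoc [simp]: "a * (u * b) = a * b"
  using mult.assoc[of a u b] by simp

lemma in_B_iff: "b \<in> B \<longleftrightarrow> u * b = b"
  unfolding B_def using mult_u_assoc[of u] by (auto simp del: mult_u_assoc) metis

lemma u_in_B: "u \<in> B"
  by (simp add: in_B_iff)

lemma mult_u_in_B: "u * a \<in> B"
  by (simp add: in_B_iff)

lemma right_annihilator_iff: "r \<in> right_annihilator \<longleftrightarrow> u * r = 0"
proof
  assume "u * r = 0"
  then have "a * r = 0" for a
    using mult_u_assoc[of a r] by simp
  then show "r \<in> right_annihilator"
    by (simp add: right_annihilator_def)
qed (simp add: right_annihilator_def)

lemma B_commute: "u * (a * b) = u * (b * a)"
proof -
  have "(u * a) * (u * b) = (u * b) * (u * a)"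
    using commut mult_u_in_B unfolding commutative_def B_def by blast
  then show ?thesis
    by (simp add: mult.assoc)
qed

lemma B_closed: "closed B"
proof -
  have "B = (\<lambda>b. u * b - b) -` {0}"
    by (auto simp: in_B_iff)
  then show ?thesis
    by (simp add: closed_vimage continuous_intros)
qed

lemma maximal_ideal:
  assumes "maximal_modular_left_ideal_of B M"
  shows "M \<subseteq> B" and "complex_vector.subspace M"
    and "b \<in> B \<Longrightarrow> m \<in> M \<Longrightarrow> b * m \<in> M"
    and "left_ideal_of B J \<Longrightarrow> M \<subseteq> J \<Longrightarrow> J = M \<or> J = B"
    and "u \<notin> M"
proof -
  show *: "M \<subseteq> B" "complex_vector.subspace M" "\<And>b m. b \<in> B \<Longrightarrow> m \<in> M \<Longrightarrow> b * m \<in> M"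
    "\<And>J. left_ideal_of B J \<Longrightarrow> M \<subseteq> J \<Longrightarrow> J = M \<or> J = B"
    using assms
    unfolding maximal_modular_left_ideal_of_def modular_left_ideal_of_def left_ideal_of_def
    by blast+
  show "u \<notin> M"
  proof
    assume "u \<in> M"
    then have "b \<in> M" if "b \<in> B" for b
      using *(3)[OF that] by fastforce
    then show False
      using assms *(1) unfolding maximal_modular_left_ideal_of_def by blast
  qed
qed

text \<open>
  An element of \<open>B\<close> at distance less than 1 from its unit is invertible in \<open>B\<close>.
\<close>

lemma unit_far_from_ideal:
  assumes "left_ideal_of B J" and "u \<notin> J" and "m \<in> J"
  shows "norm (u - m) \<ge> 1"
proof (rule ccontr)
  assume "\<not> norm (u - m) \<ge> 1"
  then obtain y where y: "y = u + (u - m) * y"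
    using contraction_fixpoint[of "u - m" u] by force
  have m: "u * m = m" "m \<in> B"
    using assms in_B_iff by (auto simp: left_ideal_of_def)
  have "u * y = u + u * ((u - m) * y)"
    using y by (metis distrib_left right_unit)
  also have "\<dots> = u + (u * (u - m)) * y"
    by (simp add: mult.assoc)
  also have "\<dots> = y"
    using m y by (simp add: right_diff_distrib)
  finally have "u * y = y" .
  then have "m * y = u"
    using y by (simp add: left_diff_distrib)
  then have "u = u * (m * y)"
    by simp
  then have "u = (u * y) * m"
    using B_commute[of m y] by (simp add: mult.assoc)
  moreover have "(u * y) * m \<in> J"
    using assms mult_u_in_B by (auto simp: left_ideal_of_def)
  ultimately show False
    using \<open>u \<notin> J\<close> by simp
qed

text \<open>
  The closure of a maximal ideal is a left ideal which, by the preceding lemma, still misses \<open>u\<close>.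
\<close>

lemma maximal_ideal_closed:
  assumes "maximal_modular_left_ideal_of B M"
  shows "closed M"
proof -
  note M = maximal_ideal[OF assms]
  have "closure M \<subseteq> B"
    using M(1) B_closed by (rule closure_minimal)
  have "left_ideal_of B (closure M)"
    unfolding left_ideal_of_def complex_vector.subspace_def
  proof (intro conjI ballI allI)
    show "0 \<in> closure M"
      using complex_vector.subspace_0[OF M(2)] closure_subset by blast
  next
    fix x y assume "x \<in> closure M" "y \<in> closure M"
    then obtain X Y where "\<And>n. X n \<in> M" "X \<longlonglongrightarrow> x" "\<And>n. Y n \<in> M" "Y \<longlonglongrightarrow> y"
      unfolding closure_sequential by blast
    then show "x + y \<in> closure M"
      unfolding closure_sequential
      by (intro exI[of _ "\<lambda>n. X n + Y n"])
        (auto intro: tendsto_add complex_vector.subspace_add[OF M(2)])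
  next
    fix z x assume "x \<in> closure M"
    then obtain X where X: "\<And>n. X n \<in> M" "X \<longlonglongrightarrow> x"
      unfolding closure_sequential by blast
    have "bounded_linear (\<lambda>x::'a. z *\<^sub>C x)"
      by (rule bounded_linear_intro[of _ "cmod z"])
        (simp_all add: scaleC_add_right norm_scaleC scaleC_scaleC mult.commute flip: scaleC_of_real)
    then have "(\<lambda>n. z *\<^sub>C X n) \<longlonglongrightarrow> z *\<^sub>C x"
      using X(2) by (rule bounded_linear.tendsto)
    then show "z *\<^sub>C x \<in> closure M"
      unfolding closure_sequential using X(1) complex_vector.subspace_scale[OF M(2)]
      by (intro exI[of _ "\<lambda>n. z *\<^sub>C X n"]) auto
  next
    fix b x assume "b \<in> B" "x \<in> closure M"
    then obtain X where "\<And>n. X n \<in> M" "X \<longlonglongrightarrow> x"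
      unfolding closure_sequential by blast
    then show "b * x \<in> closure M"
      unfolding closure_sequential using M(3)[OF \<open>b \<in> B\<close>]
      by (intro exI[of _ "\<lambda>n. b * X n"]) (auto intro: tendsto_mult_left)
  qed (use \<open>closure M \<subseteq> B\<close> in blast)
  moreover have "u \<notin> closure M"
  proof
    assume "u \<in> closure M"
    then obtain m where "m \<in> M" "dist m u < 1"
      unfolding closure_approachable using zero_less_one by blast
    moreover have "left_ideal_of B M"
      using M by (simp add: left_ideal_of_def)
    ultimately show False
      using unit_far_from_ideal[of M m] M(5) by (simp add: dist_norm norm_minus_commute)
  qed
  ultimately have "closure M = M"
    using M(4) closure_subset u_in_B by blast
  then show ?thesis
    by (metis closed_closure)
qed

text \<open>
  Pulling a maximal ideal of \<open>B\<close> back along \<open>a \<mapsto> u * a\<close> gives a two-sided ideal of \<open>A\<close> with the same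
  quotient. It contains all commutators, because \<open>B\<close> is commutative.
\<close>

lemma banach_field_quotient_preimage:
  assumes "maximal_modular_left_ideal_of B M"
  shows "banach_field_quotient u {a. u * a \<in> M}"
proof
  note M = maximal_ideal[OF assms]
  show "a * u = a" for a
    by simp
  show "complex_vector.subspace {a. u * a \<in> M}"
    using M(2) by (auto simp: complex_vector.subspace_def distrib_left mult_scaleC_right)
  have "{a. u * a \<in> M} = (\<lambda>a. u * a) -` M"
    by auto
  then show "closed {a. u * a \<in> M}"
    using maximal_ideal_closed[OF assms]
    by (simp add: closed_vimage continuous_on_mult_left)
  show left: "a * m \<in> {a. u * a \<in> M}" if "m \<in> {a. u * a \<in> M}" for a m
  proof -
    have "(u * a) * (u * m) \<in> M"
      using that M(3)[OF mult_u_in_B, of "u * m" a] by simp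
    then show ?thesis
      by (simp add: mult.assoc)
  qed
  show "m * a \<in> {a. u * a \<in> M}" if "m \<in> {a. u * a \<in> M}" for a m
    using left[OF that, of a] B_commute[of a m] by simp
  show "a * b - b * a \<in> {a. u * a \<in> M}" for a b
    using B_commute[of a b] complex_vector.subspace_0[OF M(2)] by (simp add: right_diff_distrib)
  show "u \<notin> {a. u * a \<in> M}"
    using M(5) by simp
  show "\<exists>b. b * a - u \<in> {a. u * a \<in> M}" if "a \<notin> {a. u * a \<in> M}" for a
  proof -
    \<comment> \<open>The left ideal generated by \<open>M\<close> and \<open>u * a\<close> must be all of \<open>B\<close>.\<close>
    define J where "J = {(u * b) * a + m | b m. m \<in> M}"
    have "left_ideal_of B J"
      unfolding left_ideal_of_def complex_vector.subspace_def
    proof (intro conjI ballI allI)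
      show "J \<subseteq> B"
        using M(1) unfolding J_def by (auto simp: in_B_iff distrib_left mult.assoc subset_iff)
      show "0 \<in> J"
        unfolding J_def using complex_vector.subspace_0[OF M(2)] by (force intro: exI[of _ 0])
    next
      fix x y assume "x \<in> J" "y \<in> J"
      then obtain b m b' m' where "x = (u * b) * a + m" "m \<in> M" "y = (u * b') * a + m'" "m' \<in> M"
        unfolding J_def by blast
      then have "x + y = (u * (b + b')) * a + (m + m')" "m + m' \<in> M"
        using complex_vector.subspace_add[OF M(2)] by (simp_all add: algebra_simps)
      then show "x + y \<in> J"
        unfolding J_def by blast
    next
      fix z x assume "x \<in> J"
      then obtain b m where "x = (u * b) * a + m" "m \<in> M"
        unfolding J_def by blast
      then have "z *\<^sub>C x = (u * (z *\<^sub>C b)) * a + z *\<^sub>C m" "z *\<^sub>C m \<in> M"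
        using complex_vector.subspace_scale[OF M(2)]
        by (simp_all add: scaleC_add_right mult_scaleC_left mult_scaleC_right)
      then show "z *\<^sub>C x \<in> J"
        unfolding J_def by blast
    next
      fix c x assume "c \<in> B" "x \<in> J"
      then obtain b m where x: "x = (u * b) * a + m" "m \<in> M"
        unfolding J_def by blast
      have "c * x = (u * (c * b)) * a + c * m"
        using \<open>c \<in> B\<close> x(1) unfolding in_B_iff by (metis distrib_left mult.assoc mult_u_assoc)
      then show "c * x \<in> J"
        unfolding J_def using M(3)[OF \<open>c \<in> B\<close> x(2)] by blast
    qed
    moreover have "M \<subseteq> J"
      unfolding J_def by (force intro: exI[of _ 0])
    moreover have "u * a \<in> J"
    proof -
      have "u * a = (u * u) * a + 0"
        by simp
      then show ?thesis
        unfolding J_def using complex_vector.subspace_0[OF M(2)] by blast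
    qed
    ultimately have "u \<in> J"
      using M(4)[of J] that u_in_B by blast
    then obtain b m where b: "u = (u * b) * a + m" "m \<in> M"
      unfolding J_def by blast
    then have "u * b * a - u = 0 - m"
      by (metis add_diff_cancel_left' diff_0 minus_diff_eq)
    moreover have "u * (b * a - u) = u * b * a - u"
      by (simp add: right_diff_distrib mult.assoc)
    ultimately have "u * (b * a - u) \<in> M"
      using complex_vector.subspace_neg[OF M(2) b(2)] by simp
    then show ?thesis
      by blast
  qed
qed

text \<open>
  By Gelfand-Mazur every element is congruent to a complex multiple of \<open>u\<close>, and the
  coefficient is a character.
\<close>

lemma character_of_maximal_ideal:
  assumes "maximal_modular_left_ideal_of B M"
  obtains \<phi> where "character \<phi>" "\<And>a. \<phi> a = 0 \<Longrightarrow> u * a \<in> M"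
proof -
  interpret Q: banach_field_quotient u "{a. u * a \<in> M}"
    using assms by (rule banach_field_quotient_preimage)
  let ?M = "{a. u * a \<in> M}"
  obtain \<phi> where \<phi>: "\<And>a. a - \<phi> a *\<^sub>C u \<in> ?M"
    using Q.spectrum_nonempty by metis
  have cong: "Q.cong a (\<phi> a *\<^sub>C u)" for a
    using \<phi> by (simp add: Q.cong_def)
  have unique: "\<phi> a = z" if "Q.cong a (z *\<^sub>C u)" for a z
  proof (rule ccontr)
    assume "\<phi> a \<noteq> z"
    have "Q.cong (z *\<^sub>C u) (\<phi> a *\<^sub>C u)"
      using Q.cong_trans[OF Q.cong_sym[OF that] cong] .
    then have "(z - \<phi> a) *\<^sub>C u \<in> ?M"
      by (simp add: Q.cong_def complex_vector.scale_left_diff_distrib)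
    then have "inverse (z - \<phi> a) *\<^sub>C ((z - \<phi> a) *\<^sub>C u) \<in> ?M"
      by (rule complex_vector.subspace_scale[OF Q.subspace])
    then have "u \<in> ?M"
      using \<open>\<phi> a \<noteq> z\<close> by (simp only: scaleC_scaleC) simp
    then show False
      using Q.proper by blast
  qed
  show ?thesis
  proof
    show "character \<phi>"
      unfolding character_def
    proof (intro conjI allI exI)
      fix x y z
      show "\<phi> (x + y) = \<phi> x + \<phi> y"
        by (rule unique) (simp only: scaleC_add_left Q.cong_add cong)
      show "\<phi> (z *\<^sub>C x) = z * \<phi> x"
        by (rule unique) (simp only: Q.cong_scaleC cong flip: scaleC_scaleC)
      show "\<phi> (x * y) = \<phi> x * \<phi> y"
        using Q.cong_mult[OF cong cong, of x y] by (intro unique) (simp add: Q.scaleC_mult_scaleC)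
      have "\<phi> u = 1"
        by (rule unique) simp
      then show "\<phi> u \<noteq> 0"
        by simp
    qed
    show "u * a \<in> M" if "\<phi> a = 0" for a
      using \<phi>[of a] that by simp
  qed
qed

text \<open>
  Multiplied by \<open>u\<close>, an element killed by all characters lies in every maximal ideal of \<open>B\<close>,
  hence in the radical. This is the only place where semisimplicity enters.
\<close>

lemma characters_separate:
  assumes "\<And>\<phi>. character \<phi> \<Longrightarrow> \<phi> a = 0"
  shows "u * a = 0"
proof -
  have "u * a \<in> M" if "maximal_modular_left_ideal_of B M" for M
    using character_of_maximal_ideal[OF that] assms by metis
  then have "u * a \<in> jacobson_radical_of B"
    unfolding jacobson_radical_of_def using mult_u_in_B by blast
  then show ?thesis
    using semisimp by (simp add: semisimple_def B_def)
qed

lemma character_u: "character \<phi> \<Longrightarrow> \<phi> u = 1"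
  by (metis character_mult character_nonzero mult_cancel_left1 mult_cancel_right1 right_unit mult.commute)

lemma character_annihilated: "character \<phi> \<Longrightarrow> u * r = 0 \<Longrightarrow> \<phi> r = 0"
  by (metis character_mult character_u character_zero mult_1)

end

section \<open>Automatic continuity of derivations\<close>

definition derivation :: "('a::complex_banach_algebra \<Rightarrow> 'a) \<Rightarrow> bool" where
  "derivation d \<longleftrightarrow> (\<forall>x y. d (x + y) = d x + d y) \<and> (\<forall>z x. d (z *\<^sub>C x) = z *\<^sub>C d x) \<and>
     (\<forall>x y. d (x * y) = d x * y + x * d y)"

locale right_unital_derivation = right_unital_semisimple u
  for u :: "'a::complex_banach_algebra" +
  fixes d :: "'a \<Rightarrow> 'a"
  assumes deriv: "derivation d"
begin

lemma d_add: "d (x + y) = d x + d y"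
  and d_scaleC: "d (z *\<^sub>C x) = z *\<^sub>C d x"
  and d_mult: "d (x * y) = d x * y + x * d y"
  using deriv by (auto simp: derivation_def)

lemma d_scaleR: "d (r *\<^sub>R x) = r *\<^sub>R d x"
  using d_scaleC[of "complex_of_real r" x] by (simp add: scaleC_of_real)

lemma linear_d: "linear d"
  by (rule linearI) (simp_all add: d_add d_scaleR)

lemma d_diff: "d (x - y) = d x - d y"
  by (rule linear_diff[OF linear_d])

text \<open>
  So \<open>d\<close> induces a derivation of \<open>A / ran(A)\<close>, and congruences modulo \<open>ran(A)\<close> may be
  differentiated.
\<close>

lemma d_annihilator:
  assumes "u * r = 0"
  shows "u * d r = 0"
proof -
  have "d u * r = d u * (u * r)"
    by simp
  then have "d u * r = 0"
    using assms by (simp del: mult_u_assoc)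
  moreover have "d (u * r) = 0"
    using assms linear_0[OF linear_d] by simp
  ultimately show ?thesis
    by (simp add: d_mult)
qed

lemma character_d_mult:
  "character \<phi> \<Longrightarrow> \<phi> (d (x * y)) = \<phi> (d x) * \<phi> y + \<phi> x * \<phi> (d y)"
  by (simp add: d_mult character_add character_mult)

lemma character_d_annihilator: "character \<phi> \<Longrightarrow> u * r = 0 \<Longrightarrow> \<phi> (d r) = 0"
  by (simp add: character_annihilated d_annihilator)

lemma character_d_u:
  assumes "character \<phi>"
  shows "\<phi> (d u) = 0"
  using character_d_mult[OF assms, of u u] by (simp add: character_u[OF assms])

definition discontinuous :: "('a \<Rightarrow> complex) set" where
  "discontinuous = {\<phi>. character \<phi> \<and> \<not> bounded_linear (\<lambda>x. \<phi> (d x))}"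

lemma discontinuous_character: "\<phi> \<in> discontinuous \<Longrightarrow> character \<phi>"
  by (simp add: discontinuous_def)

lemma discontinuous_large:
  assumes "\<phi> \<in> discontinuous" and "\<epsilon> > 0"
  shows "\<exists>x. norm x \<le> \<epsilon> \<and> cmod (\<phi> (d x)) \<ge> K"
proof (rule ccontr)
  have \<phi>: "character \<phi>" and unbounded: "\<not> bounded_linear (\<lambda>x. \<phi> (d x))"
    using assms(1) by (auto simp: discontinuous_def)
  assume "\<not> ?thesis"
  then have small: "cmod (\<phi> (d x)) \<le> K" if "norm x \<le> \<epsilon>" for x
    using that by force
  have "bounded_linear (\<lambda>x. \<phi> (d x))"
  proof (rule bounded_linear_intro[of _ "K / \<epsilon>"])
    fix x y r
    show "\<phi> (d (x + y)) = \<phi> (d x) + \<phi> (d y)"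
      by (simp add: d_add character_add[OF \<phi>])
    show scale: "\<phi> (d (r *\<^sub>R x)) = r *\<^sub>R \<phi> (d x)" for r x
      by (simp add: d_scaleR linear_scale[OF bounded_linear.linear[OF bounded_linear_character[OF \<phi>]]])
    show "cmod (\<phi> (d x)) \<le> norm x * (K / \<epsilon>)"
    proof (cases "x = 0")
      case True
      then show ?thesis
        using scale[of 0 x] by simp
    next
      case False
      have "cmod (\<phi> (d ((\<epsilon> / norm x) *\<^sub>R x))) \<le> K"
        using False assms(2) by (intro small) simp
      then show ?thesis
        using False assms(2) by (simp add: scale field_simps)
    qed
  qed
  then show False
    using unbounded by blast
qed

text \<open>
  For \<open>i \<noteq> j\<close> the elements on which \<open>\<phi> i\<close> and \<open>\<phi> j\<close> agree form a proper closed subspace, and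
  countably many of those do not cover a Banach space.
\<close>

lemma separating_element:
  fixes \<phi> :: "nat \<Rightarrow> 'a \<Rightarrow> complex"
  assumes "inj \<phi>" and \<phi>: "\<And>n. character (\<phi> n)"
  obtains a where "inj (\<lambda>n. \<phi> n a)"
proof -
  define I where "I = {(i, j). i \<noteq> (j::nat)}"
  define C where "C = (\<lambda>(i, j). {a. \<phi> i a = \<phi> j a})"
  have lin: "bounded_linear (\<lambda>a. \<phi> i a - \<phi> j a)" for i j
    by (intro bounded_linear_sub bounded_linear_character \<phi>)
  have C: "C (i, j) = (\<lambda>a. \<phi> i a - \<phi> j a) -` {0}" for i j
    by (auto simp: C_def)
  have "(\<Union>p\<in>I. C p) \<noteq> UNIV"
  proof
    assume "(\<Union>p\<in>I. C p) = UNIV"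
    moreover have "closed (C p)" for p
      using lin by (cases p) (auto simp: C intro!: closed_vimage linear_continuous_on)
    ultimately obtain p where "p \<in> I" "interior (C p) \<noteq> {}"
      using countable_closed_cover_has_interior[of I C] by blast
    then obtain i j where "i \<noteq> j" and int: "interior (C (i, j)) \<noteq> {}"
      by (auto simp: I_def)
    have "subspace (C (i, j))"
      using linear_subspace_kernel[OF bounded_linear.linear[OF lin[of i j]]]
      by (simp add: C vimage_def)
    then have "C (i, j) = UNIV"
      using int by (rule subspace_with_interior)
    then have "\<phi> i = \<phi> j"
      by (auto simp: C_def)
    then show False
      using \<open>inj \<phi>\<close> \<open>i \<noteq> j\<close> by (simp add: inj_eq)
  qed
  then obtain a where "\<And>p. p \<in> I \<Longrightarrow> a \<notin> C p"
    by blast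
  then have "inj (\<lambda>n. \<phi> n a)"
    unfolding inj_def by (force simp: I_def C_def)
  then show ?thesis
    by (rule that)
qed

text \<open>
  Johnson's argument. Given infinitely many \<open>\<phi> n\<close>, choose \<open>c n\<close> in the kernel of \<open>\<phi> n\<close> and of
  no other \<open>\<phi> m\<close>. By the product rule \<open>\<phi> n \<circ> d\<close> vanishes on all multiples of \<open>(c n)\<^sup>2\<close>, so the
  gliding hump lemma applies to the multiplications by \<open>(c n)\<^sup>2\<close>: for some \<open>n\<close>, the
  functional \<open>x \<mapsto> \<phi> n (d (b * x))\<close> is bounded, where \<open>b = u (c 0)\<^sup>2 \<dots> (c (n - 1))\<^sup>2\<close>. As
  \<open>\<phi> n b \<noteq> 0\<close>, so is \<open>\<phi> n \<circ> d\<close>.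
\<close>

lemma finite_discontinuous: "finite discontinuous"
proof (rule ccontr)
  assume "infinite discontinuous"
  then obtain \<phi> :: "nat \<Rightarrow> 'a \<Rightarrow> complex" where "inj \<phi>" and range: "range \<phi> \<subseteq> discontinuous"
    using infinite_countable_subset by blast
  have disc: "\<phi> n \<in> discontinuous" and \<phi>: "character (\<phi> n)" for n
    using range by (auto simp: discontinuous_def)
  obtain a where "inj (\<lambda>n. \<phi> n a)"
    using separating_element[OF \<open>inj \<phi>\<close> \<phi>] by blast
  define c where "c n = a - \<phi> n a *\<^sub>C u" for n
  have \<phi>_c: "\<phi> m (c n) = \<phi> m a - \<phi> n a" for m n
    by (simp add: c_def character_diff[OF \<phi>] character_scaleC[OF \<phi>] character_u[OF \<phi>])
  define b where "b = rec_nat u (\<lambda>n b. b * (c n * c n))"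
  have b_0: "b 0 = u" and b_Suc: "b (Suc n) = b n * (c n * c n)" for n
    by (simp_all add: b_def)
  define P where "P n x = b n * x" for n x
  have \<phi>_P: "\<phi> n (d (P m x)) = \<phi> n (d (b m)) * \<phi> n x + \<phi> n (b m) * \<phi> n (d x)" for n m x
    by (simp add: P_def character_d_mult[OF \<phi>])
  obtain n \<epsilon> K where "\<epsilon> > 0" and bound: "\<And>x. norm x \<le> \<epsilon> \<Longrightarrow> cmod (\<phi> n (d (P n x))) < K"
  proof (rule gliding_hump[of "\<lambda>n x. c n * c n * x" P "\<lambda>n x. \<phi> n (d x)"])
    show "bounded_linear ((*) (c n * c n))" for n
      by (rule bounded_linear_mult_right)
    show "bounded_linear (P 0)"
      unfolding P_def by (rule bounded_linear_mult_right)
    show "P (Suc n) x = P n (c n * c n * x)" for n x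
      by (simp add: P_def b_Suc mult.assoc)
    show "\<phi> n (d (x + y)) = \<phi> n (d x) + \<phi> n (d y)" for n x y
      by (simp add: d_add character_add[OF \<phi>])
    show "\<exists>K. \<forall>n. cmod (\<phi> n (d x)) \<le> K" for x
      using character_norm_le[OF \<phi>] by blast
    show "\<phi> n (d (P (Suc n) x)) = 0" for n x
      by (simp add: \<phi>_P b_Suc character_d_mult[OF \<phi>] character_mult[OF \<phi>] \<phi>_c)
  qed blast
  have "\<phi> n (b m) \<noteq> 0" if "m \<le> n" for m
    using that
  proof (induction m)
    case (Suc m)
    then have "\<phi> n a \<noteq> \<phi> m a"
      using \<open>inj (\<lambda>n. \<phi> n a)\<close> by (metis Suc_n_not_le_n injD)
    then show ?case
      using Suc by (simp add: b_Suc character_mult[OF \<phi>] \<phi>_c)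
  qed (simp add: b_0 character_u[OF \<phi>])
  then have "\<phi> n (b n) \<noteq> 0"
    by simp
  define C where "C = cmod (\<phi> n (d (b n))) * \<epsilon>"
  obtain x where x: "norm x \<le> \<epsilon>" "cmod (\<phi> n (d x)) \<ge> (K + C) / cmod (\<phi> n (b n))"
    using discontinuous_large[OF disc \<open>\<epsilon> > 0\<close>] by blast
  have "K + C \<le> cmod (\<phi> n (b n) * \<phi> n (d x))"
    using x(2) \<open>\<phi> n (b n) \<noteq> 0\<close> by (simp add: norm_mult field_simps)
  also have "\<phi> n (b n) * \<phi> n (d x) = \<phi> n (d (P n x)) - \<phi> n (d (b n)) * \<phi> n x"
    by (simp add: \<phi>_P)
  also have "cmod \<dots> \<le> cmod (\<phi> n (d (P n x))) + cmod (\<phi> n (d (b n)) * \<phi> n x)"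
    by (rule norm_triangle_ineq4)
  also have "cmod (\<phi> n (d (b n)) * \<phi> n x) \<le> C"
    unfolding C_def norm_mult using character_norm_le[OF \<phi>, of n x] x(1)
    by (intro mult_left_mono) auto
  finally show False
    using bound[OF x(1)] by simp
qed

text \<open>
  A product of elements each of which separates \<open>\<phi>0\<close> from one member of \<open>F\<close>.
\<close>

lemma isolating_element:
  fixes \<phi>0 :: "'a \<Rightarrow> complex"
  assumes "finite F" and "\<And>\<phi>. \<phi> \<in> F \<Longrightarrow> character \<phi>" and \<phi>0: "character \<phi>0" "\<phi>0 \<notin> F"
  shows "\<exists>g. \<phi>0 g = 1 \<and> (\<forall>\<phi>\<in>F. \<phi> g = 0)"
  using assms(1,2,4)
proof (induction F)
  case empty
  then show ?case
    using character_u[OF \<phi>0(1)] by blast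
next
  case (insert \<psi> F)
  then obtain g where g: "\<phi>0 g = 1" "\<forall>\<phi>\<in>F. \<phi> g = 0"
    by auto
  have \<psi>: "character \<psi>"
    using insert.prems by simp
  obtain x where x: "\<phi>0 x \<noteq> \<psi> x"
    using insert.prems by fastforce
  define c where "c = inverse (\<phi>0 x - \<psi> x) *\<^sub>C (x - \<psi> x *\<^sub>C u)"
  have "\<phi>0 c = 1" "\<psi> c = 0"
    using x \<phi>0(1) \<psi> by (simp_all add: c_def character_scaleC character_diff character_u)
  then show ?case
    using g insert.prems \<phi>0(1) by (intro exI[of _ "c * g"]) (auto simp: character_mult)
qed

text \<open>
  The finitely many discontinuous points are invisible. If \<open>a\<close> vanished at all characters outside
  this finite set but not at a point \<open>\<phi>0\<close> of it, then some multiple \<open>e\<close> of \<open>a\<close> would take the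
  value 1 at \<open>\<phi>0\<close> and 0 at all other characters. Modulo \<open>ran(A)\<close> it is idempotent, so
  \<open>\<phi>0 (d e) = 0\<close>, and \<open>e * x\<close> is \<open>\<phi>0 x\<close> times \<open>e\<close>; differentiating gives
  \<open>\<phi>0 (d x) = 0\<close> for all \<open>x\<close>, so \<open>\<phi>0 \<circ> d\<close> is continuous after all.
\<close>

lemma vanishes_off_discontinuous:
  assumes J: "\<And>\<phi>. character \<phi> \<Longrightarrow> \<phi> \<notin> discontinuous \<Longrightarrow> \<phi> a = 0"
  shows "u * a = 0"
proof (rule characters_separate)
  fix \<phi>0 :: "'a \<Rightarrow> complex"
  assume \<phi>0: "character \<phi>0"
  show "\<phi>0 a = 0"
  proof (rule ccontr)
    assume "\<phi>0 a \<noteq> 0"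
    then have "\<phi>0 \<in> discontinuous"
      using J \<phi>0 by blast
    obtain g where g: "\<phi>0 g = 1" "\<And>\<phi>. \<phi> \<in> discontinuous - {\<phi>0} \<Longrightarrow> \<phi> g = 0"
    proof -
      have "\<exists>g. \<phi>0 g = 1 \<and> (\<forall>\<phi>\<in>discontinuous - {\<phi>0}. \<phi> g = 0)"
        using finite_discontinuous \<phi>0
        by (intro isolating_element) (auto dest: discontinuous_character)
      then show ?thesis
        using that by blast
    qed
    define e where "e = inverse (\<phi>0 a) *\<^sub>C (a * g)"
    have e0: "\<phi>0 e = 1"
      using \<open>\<phi>0 a \<noteq> 0\<close> g \<phi>0 by (simp add: e_def character_scaleC character_mult)
    have e: "\<phi> e = 0" if "character \<phi>" "\<phi> \<noteq> \<phi>0" for \<phi>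
      using that J[of \<phi>] g(2)[of \<phi>] by (auto simp: e_def character_scaleC character_mult)
    have "u * (e * e - e) = 0"
    proof (rule characters_separate)
      fix \<phi> :: "'a \<Rightarrow> complex" assume "character \<phi>"
      then show "\<phi> (e * e - e) = 0"
        using e[of \<phi>] e0 by (cases "\<phi> = \<phi>0") (simp_all add: character_diff character_mult)
    qed
    then have "\<phi>0 (d (e * e - e)) = 0"
      using \<phi>0 by (simp add: character_d_annihilator)
    then have de: "\<phi>0 (d e) = 0"
      using e0 \<phi>0 by (simp add: d_diff character_diff character_d_mult)
    have "\<phi>0 (d x) = 0" for x
    proof -
      have "u * (e * x - \<phi>0 x *\<^sub>C e) = 0"
      proof (rule characters_separate)
        fix \<phi> :: "'a \<Rightarrow> complex" assume "character \<phi>"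
        then show "\<phi> (e * x - \<phi>0 x *\<^sub>C e) = 0"
          using e[of \<phi>] e0
          by (cases "\<phi> = \<phi>0") (simp_all add: character_diff character_mult character_scaleC)
      qed
      then have "\<phi>0 (d (e * x - \<phi>0 x *\<^sub>C e)) = 0"
        using \<phi>0 by (simp add: character_d_annihilator)
      then show ?thesis
        using e0 de \<phi>0 by (simp add: d_diff d_scaleC character_diff character_d_mult character_scaleC)
    qed
    then have "bounded_linear (\<lambda>x. \<phi>0 (d x))"
      by (simp add: bounded_linear_zero)
    then show False
      using \<open>\<phi>0 \<in> discontinuous\<close> by (simp add: discontinuous_def)
  qed
qed

text \<open>
  A limit \<open>y\<close> of \<open>u * d (X n)\<close> is determined by the characters at which \<open>d\<close> is continuous, hence
  the graph is closed.
\<close>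

lemma bounded_linear_u_d: "bounded_linear (\<lambda>x. u * d x)"
proof (rule closed_graph_theorem)
  show "linear (\<lambda>x. u * d x)"
    by (rule linearI) (simp_all add: d_add d_scaleR distrib_left)
next
  fix X x y
  assume X: "X \<longlonglongrightarrow> x" and Y: "(\<lambda>n. u * d (X n)) \<longlonglongrightarrow> y"
  have "u * (d x - y) = 0"
  proof (rule vanishes_off_discontinuous)
    fix \<phi> :: "'a \<Rightarrow> complex"
    assume \<phi>: "character \<phi>" and "\<phi> \<notin> discontinuous"
    then have "(\<lambda>n. \<phi> (d (X n))) \<longlonglongrightarrow> \<phi> (d x)"
      using X by (auto simp: discontinuous_def intro: bounded_linear.tendsto)
    moreover have "(\<lambda>n. \<phi> (u * d (X n))) \<longlonglongrightarrow> \<phi> y"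
      using bounded_linear_character[OF \<phi>] Y by (rule bounded_linear.tendsto)
    ultimately have "\<phi> (d x) = \<phi> y"
      using LIMSEQ_unique by (simp add: \<phi> character_mult character_u)
    then show "\<phi> (d x - y) = 0"
      by (simp add: \<phi> character_diff)
  qed
  moreover have "u * y = y"
  proof -
    have "(\<lambda>n. u * (u * d (X n))) \<longlonglongrightarrow> u * y"
      using Y by (rule tendsto_mult_left)
    then show ?thesis
      using Y LIMSEQ_unique by simp
  qed
  ultimately show "u * d x = y"
    unfolding right_diff_distrib by (simp only: right_minus_eq)
qed

lemma u_d_iter: "u * (d ^^ n) x = ((\<lambda>x. u * d x) ^^ n) (u * x)"
proof (induction n)
  case (Suc n)
  let ?y = "(d ^^ n) x"
  have "u * d (?y - u * ?y) = 0"
    by (rule d_annihilator) (simp add: right_diff_distrib)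
  then have "u * d ?y = u * d (u * ?y)"
    by (simp add: d_diff right_diff_distrib)
  also have "\<dots> = u * d (((\<lambda>x. u * d x) ^^ n) (u * x))"
    by (simp only: Suc)
  finally show ?case
    by simp
qed simp

lemma character_d_iter_bound:
  obtains K where "K \<ge> 0" and
    "\<And>\<phi> n x. character \<phi> \<Longrightarrow> cmod (\<phi> ((d ^^ n) x)) \<le> K ^ n * norm (u * x)"
proof -
  obtain K where "K > 0" and K: "\<And>x. norm (u * d x) \<le> norm x * K"
    using bounded_linear.pos_bounded[OF bounded_linear_u_d] by blast
  have iter: "norm (((\<lambda>x. u * d x) ^^ n) x) \<le> K ^ n * norm x" for n x
  proof (induction n)
    case (Suc n)
    then have "norm (((\<lambda>x. u * d x) ^^ n) x) * K \<le> K ^ n * norm x * K"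
      using \<open>K > 0\<close> by (intro mult_right_mono) auto
    then show ?case
      using K[of "((\<lambda>x. u * d x) ^^ n) x"] by (simp add: mult_ac)
  qed simp
  show ?thesis
  proof (rule that[of K])
    fix \<phi> :: "'a \<Rightarrow> complex" and n x
    assume \<phi>: "character \<phi>"
    have "\<phi> ((d ^^ n) x) = \<phi> (u * (d ^^ n) x)"
      by (simp add: character_mult[OF \<phi>] character_u[OF \<phi>])
    also have "cmod \<dots> \<le> norm (u * (d ^^ n) x)"
      by (rule character_norm_le[OF \<phi>])
    also have "\<dots> \<le> K ^ n * norm (u * x)"
      by (simp add: u_d_iter iter)
    finally show "cmod (\<phi> ((d ^^ n) x)) \<le> K ^ n * norm (u * x)" .
  qed (use \<open>K > 0\<close> in simp)
qed

section \<open>Vanishing of derivations\<close>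

text \<open>
  The numbers \<open>\<phi> (d\<^sup>j x) / j!\<close> are the Taylor coefficients of \<open>x\<close> along the formal flow of \<open>d\<close>
  at \<open>\<phi>\<close>; by the Leibniz rule \<open>x\<close> is mapped to its Taylor series multiplicatively. The next
  lemmas extract from this the leading coefficients of products, which avoids binomial sums.
\<close>

definition vanishes_to_order :: "('a \<Rightarrow> complex) \<Rightarrow> nat \<Rightarrow> 'a \<Rightarrow> bool" where
  "vanishes_to_order \<phi> n x \<longleftrightarrow> (\<forall>j<n. \<phi> ((d ^^ j) x) = 0)"

lemma d_iter_add: "(d ^^ n) (x + y) = (d ^^ n) x + (d ^^ n) y"
  by (induction n) (simp_all add: d_add)

lemma d_iter_Suc_mult: "(d ^^ Suc n) (x * y) = (d ^^ n) (d x * y) + (d ^^ n) (x * d y)"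
  by (simp only: funpow_Suc_right o_apply d_mult d_iter_add)

lemma vanishes_to_order_Suc:
  "vanishes_to_order \<phi> (Suc n) x \<longleftrightarrow> \<phi> x = 0 \<and> vanishes_to_order \<phi> n (d x)"
  by (auto simp: vanishes_to_order_def less_Suc_eq_0_disj funpow_swap1)

lemma vanishes_to_order_SucD: "vanishes_to_order \<phi> (Suc n) x \<Longrightarrow> vanishes_to_order \<phi> n x"
  by (simp add: vanishes_to_order_def)

lemma vanishes_to_order_mult:
  assumes "character \<phi>" and "vanishes_to_order \<phi> n x"
  shows "vanishes_to_order \<phi> n (b * x)"
  using assms(2)
proof (induction n arbitrary: b x)
  case (Suc n)
  have "\<phi> x = 0" "vanishes_to_order \<phi> n x" "vanishes_to_order \<phi> n (d x)"
    using Suc.prems vanishes_to_order_SucD[OF Suc.prems] by (auto simp: vanishes_to_order_Suc)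
  then have "vanishes_to_order \<phi> n (d b * x)" "vanishes_to_order \<phi> n (b * d x)"
    using Suc.IH by auto
  then have "vanishes_to_order \<phi> n (d (b * x))"
    by (simp add: vanishes_to_order_def d_mult d_iter_add character_add[OF assms(1)])
  then show ?case
    using \<open>\<phi> x = 0\<close> by (simp add: vanishes_to_order_Suc character_mult[OF assms(1)])
qed (simp add: vanishes_to_order_def)

lemma leading_coefficient_mult:
  assumes "character \<phi>" and "vanishes_to_order \<phi> n x"
  shows "\<phi> ((d ^^ n) (b * x)) = \<phi> b * \<phi> ((d ^^ n) x)"
  using assms(2)
proof (induction n arbitrary: x)
  case (Suc n)
  have "vanishes_to_order \<phi> (Suc n) (d b * x)"
    using assms(1) Suc.prems by (rule vanishes_to_order_mult)
  then have "\<phi> ((d ^^ n) (d b * x)) = 0"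
    by (simp add: vanishes_to_order_def)
  then have "\<phi> ((d ^^ Suc n) (b * x)) = \<phi> ((d ^^ n) (b * d x))"
    unfolding d_iter_Suc_mult by (simp add: character_add[OF assms(1)])
  also have "\<dots> = \<phi> b * \<phi> ((d ^^ n) (d x))"
    using Suc by (simp add: vanishes_to_order_Suc)
  finally show ?case
    by (simp add: funpow_swap1)
qed (simp add: character_mult[OF assms(1)])

lemma leading_coefficient_mult_kernel:
  assumes "character \<phi>" and "\<phi> a = 0" and "vanishes_to_order \<phi> n x"
  shows "vanishes_to_order \<phi> (Suc n) (a * x) \<and>
    \<phi> ((d ^^ Suc n) (a * x)) = of_nat (Suc n) * \<phi> (d a) * \<phi> ((d ^^ n) x)"
  using assms(3)
proof (induction n arbitrary: x)
  case 0
  then show ?case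
    using assms(1,2) by (simp add: vanishes_to_order_def character_mult character_d_mult)
next
  case (Suc n)
  have 1: "vanishes_to_order \<phi> (Suc n) (a * x)"
    using assms(1) Suc.prems by (rule vanishes_to_order_mult)
  have "vanishes_to_order \<phi> n x" "vanishes_to_order \<phi> n (d x)"
    using Suc.prems vanishes_to_order_SucD[OF Suc.prems] by (auto simp: vanishes_to_order_Suc)
  then have "\<phi> ((d ^^ Suc n) (a * x)) = 0"
    using Suc.IH Suc.prems by (simp only: vanishes_to_order_def) simp
  with 1 have "vanishes_to_order \<phi> (Suc (Suc n)) (a * x)"
    by (simp add: vanishes_to_order_def less_Suc_eq)
  moreover have "\<phi> ((d ^^ Suc (Suc n)) (a * x)) = of_nat (Suc (Suc n)) * \<phi> (d a) * \<phi> ((d ^^ Suc n) x)"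
  proof -
    have "\<phi> ((d ^^ Suc (Suc n)) (a * x)) =
        \<phi> ((d ^^ Suc n) (d a * x)) + \<phi> ((d ^^ Suc n) (a * d x))"
      unfolding d_iter_Suc_mult[of "Suc n"] by (rule character_add[OF assms(1)])
    also have "\<phi> ((d ^^ Suc n) (d a * x)) = \<phi> (d a) * \<phi> ((d ^^ Suc n) x)"
      using assms(1) Suc.prems by (rule leading_coefficient_mult)
    also have "\<phi> ((d ^^ Suc n) (a * d x)) = of_nat (Suc n) * \<phi> (d a) * \<phi> ((d ^^ n) (d x))"
      using Suc.IH \<open>vanishes_to_order \<phi> n (d x)\<close> by blast
    finally show ?thesis
      by (simp add: funpow_swap1 algebra_simps)
  qed
  ultimately show ?case
    by blast
qed

text \<open>
  If the Taylor series of \<open>a\<close> starts with \<open>\<phi> (d a) t\<close>, then that of \<open>a\<^sup>n\<close> starts with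
  \<open>\<phi> (d a)\<^sup>n t\<^sup>n\<close>. The power is written as an iterated multiplication applied to \<open>u\<close>, since the
  algebra has no two-sided unit.
\<close>

lemma d_iter_power:
  assumes "character \<phi>" and "\<phi> a = 0"
  shows "vanishes_to_order \<phi> n (((*) a ^^ n) u) \<and>
    \<phi> ((d ^^ n) (((*) a ^^ n) u)) = fact n * \<phi> (d a) ^ n"
proof (induction n)
  case 0
  then show ?case
    by (simp add: vanishes_to_order_def character_u assms)
next
  case (Suc n)
  then show ?case
    using leading_coefficient_mult_kernel[OF assms, of n "((*) a ^^ n) u"]
    by (simp add: algebra_simps)
qed

text \<open>
  The Singer-Wermer theorem without exponentials: \<open>n! \<phi> (d a)\<^sup>n = \<phi> (d\<^sup>n (a\<^sup>n))\<close> grows at most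
  geometrically in \<open>n\<close>, because \<open>u * d\<close> is bounded, and this forces \<open>\<phi> (d a) = 0\<close>.
\<close>

lemma character_d_eq_0_on_kernel:
  assumes \<phi>: "character \<phi>" and "\<phi> a = 0"
  shows "\<phi> (d a) = 0"
proof (rule ccontr)
  assume "\<phi> (d a) \<noteq> 0"
  define r where "r = cmod (\<phi> (d a))"
  have "r > 0"
    using \<open>\<phi> (d a) \<noteq> 0\<close> by (simp add: r_def)
  obtain K where "K \<ge> 0" and
    K: "\<And>\<phi> n x. character \<phi> \<Longrightarrow> cmod (\<phi> ((d ^^ n) x)) \<le> K ^ n * norm (u * x)"
    using character_d_iter_bound by blast
  define C where "C = norm u * norm u"
  have power_le: "norm (u * ((*) a ^^ n) u) \<le> norm a ^ n * C" for n
  proof -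
    have "norm (((*) a ^^ n) u) \<le> norm a ^ n * norm u"
    proof (induction n)
      case (Suc n)
      then have "norm a * norm (((*) a ^^ n) u) \<le> norm a * (norm a ^ n * norm u)"
        by (intro mult_left_mono) auto
      then show ?case
        using norm_mult_ineq[of a "((*) a ^^ n) u"] by (simp add: mult_ac)
    qed simp
    then have "norm u * norm (((*) a ^^ n) u) \<le> norm u * (norm a ^ n * norm u)"
      by (intro mult_left_mono) auto
    then show ?thesis
      using norm_mult_ineq[of u "((*) a ^^ n) u"] by (simp add: C_def mult_ac)
  qed
  have bound: "1 \<le> C * ((K * norm a / r) ^ n /\<^sub>R fact n)" for n
  proof -
    have "fact n * r ^ n = cmod (\<phi> ((d ^^ n) (((*) a ^^ n) u)))"
      using d_iter_power[OF assms, of n] by (simp add: r_def norm_mult norm_power)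
    also have "\<dots> \<le> K ^ n * norm (u * ((*) a ^^ n) u)"
      by (rule K[OF \<phi>])
    also have "\<dots> \<le> K ^ n * (norm a ^ n * C)"
      using \<open>K \<ge> 0\<close> power_le by (intro mult_left_mono) auto
    finally show ?thesis
      using \<open>r > 0\<close> by (simp add: field_simps power_mult_distrib power_divide)
  qed
  have "(\<lambda>n. C * ((K * norm a / r) ^ n /\<^sub>R fact n)) \<longlonglongrightarrow> C * 0"
    by (intro tendsto_mult_left summable_LIMSEQ_zero summable_exp_generic)
  then have "1 \<le> C * 0"
    by (rule tendsto_lowerbound) (use bound in auto)
  then show False
    by simp
qed

theorem range_in_right_annihilator: "d a \<in> right_annihilator"
  unfolding right_annihilator_iff
proof (rule characters_separate)
  fix \<phi> :: "'a \<Rightarrow> complex"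
  assume \<phi>: "character \<phi>"
  have "\<phi> (d (a - \<phi> a *\<^sub>C u)) = 0"
    by (rule character_d_eq_0_on_kernel[OF \<phi>])
      (simp add: character_diff[OF \<phi>] character_scaleC[OF \<phi>] character_u[OF \<phi>])
  then show "\<phi> (d a) = 0"
    by (simp add: d_diff d_scaleC character_diff[OF \<phi>] character_scaleC[OF \<phi>] character_d_u[OF \<phi>])
qed

end

theorem theorem2p1:
  fixes u :: "'a::complex_banach_algebra"
    and D :: "'a \<Rightarrow> 'a \<Rightarrow> 'a"
  assumes "\<And>a. a * u = a"
    and "commutative {u * a | a. True}"
    and "semisimple {u * a | a. True}"
    and "symmetric_biderivation D"
  shows "\<forall>a b. D a b \<in> right_annihilator"
proof (intro allI)
  fix a b
  have "derivation (\<lambda>x. D x b)"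
    using assms(4)
    unfolding derivation_def symmetric_biderivation_def symmetric_bilinear_def by blast
  with assms(1-3) interpret right_unital_derivation u "\<lambda>x. D x b"
    by unfold_locales
  show "D a b \<in> right_annihilator"
    by (rule range_in_right_annihilator)
qed

end
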